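(* Let $\alpha\in(0,1)$, $\varepsilon>0$ and $D>1$. Let $\widehat q_{\mu,\sigma}\in\mathcal Q_{GP}$ satisfy $$\widehat q_{\mu,\sigma}=\operatorname*{arg\,min}_{q\in\mathcal Q_{GP}}D\big(q\,\|\,p_\alpha(\cdot\mid Y^{(n)})\big)=\operatorname*{arg\,min}_{q\in\mathcal Q_{GP}}\alpha\Psi(q),$$ and assume $\widehat q_{\mu,\sigma}\ll p_\theta$. Then with $P^{(n)}_{\theta^*}$-probability at least $1-2/[(D-1)^2n\varepsilon^2]$, $$\int\frac1nD^{(n)}_\alpha(\theta,\theta^* )\,\widehat q_{\mu,\sigma}(\theta)\,d\theta\le\frac{D\alpha}{1-\alpha}\varepsilon^2+\frac{1}{n(1-\alpha)}\log\big\{P_\theta[B_n(\theta^*,\varepsilon)]^{-1}\big\}+O(n^{-1}).$$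
   Context: $Y^{(n)}=(Y_1,\dots,Y_n)$ are i.i.d. observations in $\mathbb R^p$; the model has joint density $p(Y^{(n)}\mid\theta)=p_\theta^{(n)}(Y^{(n)})$, $\theta\in\Theta\subset\mathbb R^d$; the data are generated from $P^{(n)}_{\theta^*}$ with true parameter $\theta^*$. The prior distribution $P_\theta$ has density $p_\theta$ on $\Theta$. The constant $D$ (a number) is distinct from the Kullback–Leibler divergence $D(p\|q)=D[p\|q]=\int p\log(p/q)\,d\lambda$; also $V[p\|q]=\int p\log^2(p/q)\,d\lambda$. The $\alpha$-fractional posterior is $P_\alpha(\theta\in B\mid Y^{(n)})=\int_B[p(Y^{(n)}\mid\theta)]^\alpha p_\theta(\theta)\,d\theta\big/\int_\Theta[p(Y^{(n)}\mid\theta)]^\alpha p_\theta(\theta)\,d\theta$, with density $p_\alpha(\cdot\mid Y^{(n)})$, and $$\Psi(q)=\int_\Theta q(\theta)\log\frac{p(Y^{(n)}\mid\theta^* )}{p(Y^{(n)}\mid\theta)}\,d\theta+\alpha^{-1}D[q\|p_\theta].$$ The GP-IVI variational family is $$\mathcal Q_{GP}=\Big\{q_{\mu,\sigma}(\theta)=\int_0^1\phi_\sigma(\theta-\mu(\eta))\,d\eta:\ \mu\in C[0,1],\ \sigma>0\Big\},$$ where $\phi_\sigma$ is the density of $N(0,\sigma^2I_d)$. (It arises from $\theta_i\mid\eta_i\sim N(\mu(\eta_i),\sigma^2)$, $\eta_i\sim U(0,1)$, $i=1,\dots,d$.) $D^{(n)}_\alpha(\theta,\theta^* )=D_\alpha[p^{(n)}_\theta\|p^{(n)}_{\theta^*}]$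 is the Rényi divergence of order $\alpha$, $D_\alpha[p\|q]=\frac1{\alpha-1}\log\int p^\alpha q^{1-\alpha}\,d\lambda$. Finally $$B_n(\theta^*,\varepsilon)=\{\theta:\ D[p(Y^{(n)}\mid\theta^* )\|p(Y^{(n)}\mid\theta)]\le n\varepsilon^2,\ V[p(Y^{(n)}\mid\theta^* )\|p(Y^{(n)}\mid\theta)]\le n\varepsilon^2\}.$$ $O(n^{-1})$ is as $n\to\infty$.
   Formalization: The minimum defining the arg min over the GP-IVI family is additionally assumed finite; if the divergence is infinite for every q in the family, every q is formally an arg min and the stated bound can fail. *)

theory Defs
  imports "HOL-Probability.Probability"
begin

text \<open>
  The divergences below can be infinite, and whether they are infinite matters (in the
  neighbourhoods \<open>B_set\<close> and in the minimisation). The Bochner integral, and with it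
  \<open>KL_divergence\<close> of HOL-Probability, returns 0 for functions that are not integrable.
  Logarithms and integrals are therefore taken here with values in the extended reals.
\<close>

definition elog :: "ennreal \<Rightarrow> ereal" where
  "elog x = (if x = 0 then -\<infinity> else if x = \<infinity> then \<infinity> else ereal (ln (enn2real x)))"

text \<open>
  Positive part minus negative part. If both are infinite, the value is \<open>\<infinity> - \<infinity> = \<infinity>\<close>.
\<close>

definition eintegral :: "'a measure \<Rightarrow> ('a \<Rightarrow> ereal) \<Rightarrow> ereal" where
  "eintegral M g =
     enn2ereal (\<integral>\<^sup>+ x. e2ennreal (g x) \<partial>M) - enn2ereal (\<integral>\<^sup>+ x. e2ennreal (- g x) \<partial>M)"

text \<open>
  In the next two definitions a point with \<open>p x = 0\<close> contributes 0, because
  \<open>0 * (-\<infinity>) = 0\<close> in \<open>ereal\<close>, and a point with \<open>p x > 0 = q x\<close> contributes \<open>\<infinity>\<close>.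
\<close>

definition kl_div :: "'a measure \<Rightarrow> ('a \<Rightarrow> real) \<Rightarrow> ('a \<Rightarrow> real) \<Rightarrow> ereal" where
  "kl_div M p q = eintegral M (\<lambda>x. ereal (p x) * elog (ennreal (p x) / ennreal (q x)))"

definition kl_var :: "'a measure \<Rightarrow> ('a \<Rightarrow> real) \<Rightarrow> ('a \<Rightarrow> real) \<Rightarrow> ereal" where
  "kl_var M p q = eintegral M (\<lambda>x. ereal (p x) * (elog (ennreal (p x) / ennreal (q x)))\<^sup>2)"

text \<open>Meant for \<open>0 < a < 1\<close>; the value is \<open>\<infinity>\<close> if \<open>p\<close> and \<open>q\<close> are mutually singular.\<close>

definition renyi_div :: "real \<Rightarrow> 'a measure \<Rightarrow> ('a \<Rightarrow> real) \<Rightarrow> ('a \<Rightarrow> real) \<Rightarrow> ereal" where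
  "renyi_div a M p q =
     ereal (1 / (a - 1)) * elog (\<integral>\<^sup>+ x. ennreal (p x powr a * q x powr (1 - a)) \<partial>M)"

text \<open>
  A model is given by the density \<open>f \<theta>\<close> of a single observation in \<open>\<real>\<^sup>p\<close>. A sample of size
  \<open>n\<close> is a function on \<open>{..<n}\<close>, and the i.i.d. model has the product density with respect
  to the Lebesgue measure \<open>sample_lebesgue n\<close> on \<open>(\<real>\<^sup>p)\<^sup>n\<close>.
\<close>

definition sample_lebesgue :: "nat \<Rightarrow> (nat \<Rightarrow> real^'p) measure" where
  "sample_lebesgue n = (\<Pi>\<^sub>M i\<in>{..<n}. lborel)"

definition joint_density ::
  "(real^'d \<Rightarrow> real^'p \<Rightarrow> real) \<Rightarrow> nat \<Rightarrow> real^'d \<Rightarrow> (nat \<Rightarrow> real^'p) \<Rightarrow> real" where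
  "joint_density f n \<theta> Y = (\<Prod>i<n. f \<theta> (Y i))"

definition data_measure ::
  "(real^'d \<Rightarrow> real^'p \<Rightarrow> real) \<Rightarrow> nat \<Rightarrow> real^'d \<Rightarrow> (nat \<Rightarrow> real^'p) measure" where
  "data_measure f n \<theta> = density (sample_lebesgue n) (\<lambda>Y. ennreal (joint_density f n \<theta> Y))"

definition parametric_model ::
  "(real^'d) set \<Rightarrow> (real^'d \<Rightarrow> real^'p \<Rightarrow> real) \<Rightarrow> bool" where
  "parametric_model \<Theta> f \<longleftrightarrow>
     \<Theta> \<in> sets borel \<and>
     (\<lambda>(\<theta>, y). f \<theta> y) \<in> borel_measurable (restrict_space borel \<Theta> \<Otimes>\<^sub>M borel) \<and>
     (\<forall>\<theta>\<in>\<Theta>. (\<forall>y. 0 \<le> f \<theta> y) \<and> (\<integral>\<^sup>+ y. ennreal (f \<theta> y) \<partial>lborel) = 1)"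

text \<open>A density on \<open>\<Theta>\<close> is regarded as a density on \<open>\<real>\<^sup>d\<close> that vanishes outside \<open>\<Theta>\<close>.\<close>

definition density_on :: "(real^'d) set \<Rightarrow> (real^'d \<Rightarrow> real) \<Rightarrow> bool" where
  "density_on \<Theta> \<pi> \<longleftrightarrow>
     \<pi> \<in> borel_measurable borel \<and> (\<forall>\<theta>. 0 \<le> \<pi> \<theta>) \<and> (\<forall>\<theta>. \<theta> \<notin> \<Theta> \<longrightarrow> \<pi> \<theta> = 0) \<and>
     (\<integral>\<^sup>+ \<theta>. ennreal (\<pi> \<theta>) \<partial>lborel) = 1"

definition dist_of :: "(real^'d \<Rightarrow> real) \<Rightarrow> (real^'d) measure" where
  "dist_of q = density lborel (\<lambda>\<theta>. ennreal (q \<theta>))"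

text \<open>
  The normalising integral is finite for almost all \<open>Y\<close>, since \<open>x powr \<alpha> \<le> 1 + x\<close>
  for \<open>x \<ge> 0\<close> and \<open>0 < \<alpha> < 1\<close>.
\<close>

definition frac_post ::
  "(real^'d) set \<Rightarrow> (real^'d \<Rightarrow> real^'p \<Rightarrow> real) \<Rightarrow> (real^'d \<Rightarrow> real) \<Rightarrow> real \<Rightarrow> nat
     \<Rightarrow> (nat \<Rightarrow> real^'p) \<Rightarrow> real^'d \<Rightarrow> real" where
  "frac_post \<Theta> f \<pi> \<alpha> n Y \<theta> =
     joint_density f n \<theta> Y powr \<alpha> * \<pi> \<theta>
     / (LINT \<theta>':\<Theta>|lborel. joint_density f n \<theta>' Y powr \<alpha> * \<pi> \<theta>')"

definition Psi ::
  "(real^'d) set \<Rightarrow> (real^'d \<Rightarrow> real^'p \<Rightarrow> real) \<Rightarrow> (real^'d \<Rightarrow> real) \<Rightarrow> real \<Rightarrow> real^'d \<Rightarrow> nat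
     \<Rightarrow> (nat \<Rightarrow> real^'p) \<Rightarrow> (real^'d \<Rightarrow> real) \<Rightarrow> ereal" where
  "Psi \<Theta> f \<pi> \<alpha> \<theta>s n Y q =
     eintegral (restrict_space lborel \<Theta>)
       (\<lambda>\<theta>. ereal (q \<theta>) *
          elog (ennreal (joint_density f n \<theta>s Y) / ennreal (joint_density f n \<theta> Y)))
     + ereal (1 / \<alpha>) * kl_div lborel q \<pi>"

text \<open>The density of \<open>N(0, \<sigma>\<^sup>2 I\<^sub>d)\<close>.\<close>

definition gauss_density :: "real \<Rightarrow> real^'d \<Rightarrow> real" where
  "gauss_density \<sigma> x = (\<Prod>i\<in>UNIV. normal_density 0 \<sigma> (x $ i))"

definition gp_density :: "(real \<Rightarrow> real^'d) \<Rightarrow> real \<Rightarrow> real^'d \<Rightarrow> real" where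
  "gp_density \<mu> \<sigma> \<theta> = (LINT \<eta>:{0..1}|lborel. gauss_density \<sigma> (\<theta> - \<mu> \<eta>))"

definition Q_GP :: "(real^'d \<Rightarrow> real) set" where
  "Q_GP = {gp_density \<mu> \<sigma> | \<mu> \<sigma>. continuous_on {0..1} \<mu> \<and> 0 < \<sigma>}"

text \<open>
  Membership in the arg min of an extended-real functional: the minimum is attained and finite.
  For a functional that is identically \<open>\<infinity>\<close>, \<open>is_arg_min\<close> would hold at every point.
\<close>

definition is_finite_arg_min :: "('a \<Rightarrow> ereal) \<Rightarrow> 'a set \<Rightarrow> 'a \<Rightarrow> bool" where
  "is_finite_arg_min F S x \<longleftrightarrow> is_arg_min F (\<lambda>y. y \<in> S) x \<and> \<bar>F x\<bar> \<noteq> \<infinity>"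

definition B_set ::
  "(real^'d) set \<Rightarrow> (real^'d \<Rightarrow> real^'p \<Rightarrow> real) \<Rightarrow> nat \<Rightarrow> real^'d \<Rightarrow> real \<Rightarrow> (real^'d) set" where
  "B_set \<Theta> f n \<theta>s \<epsilon> =
     {\<theta> \<in> \<Theta>.
        kl_div (sample_lebesgue n) (joint_density f n \<theta>s) (joint_density f n \<theta>) \<le> ereal (real n * \<epsilon>\<^sup>2) \<and>
        kl_var (sample_lebesgue n) (joint_density f n \<theta>s) (joint_density f n \<theta>) \<le> ereal (real n * \<epsilon>\<^sup>2)}"

end

theory Submission
  imports Defs
begin

text \<open>
  The minimum over the Gaussian-process family is attained, and this is a strong condition.
  A continuous path can stay near finitely many points for prescribed fractions of the time
  and travel between them in negligible time, so the mixing law of a density in \<open>Q_GP\<close> can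
  approximate any law with bounded support. With small bandwidths the family is therefore dense
  in relative entropy: if some \<open>q \<in> Q_GP\<close> has finite divergence from a density \<open>p\<close>, the infimum
  of \<open>KL(g \<parallel> p)\<close> over \<open>g \<in> Q_GP\<close> is 0. Hence a minimizer with a finite value equals its target
  almost everywhere (\<open>Q_GP_minimizer_eq_target\<close>), and \<open>qhat n Y\<close> is the fractional posterior.

  Density is proved by passing to limits. Fix the minimizer \<open>q\<close>, of value \<open>m\<close>, and consider the
  inequality \<open>KL(g \<parallel> p) \<ge> m\<close>, put into a form that is homogeneous in \<open>g\<close> (\<open>kl_gap m g \<ge> 0\<close>). Relative
  to the reference law \<open>q\<close>, the integrand of \<open>KL(g \<parallel> p)\<close> is bounded by an integrable function as
  long as \<open>g \<le> C q\<close>, so the inequality survives pointwise limits dominated by a multiple of \<open>q\<close>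
  (\<open>kl_gap_nonneg_limit\<close>). Since \<open>q\<close> has Gaussian tails of a fixed scale, mixtures with a smaller
  bandwidth and bounded centres are dominated by \<open>q\<close>. The inequality passes from continuous paths
  to measurable maps on \<open>[0,1]\<close>, to arbitrary mixing laws with bounded support, to continuous
  densities with bounded support, to bounded measurable ones, and so to \<open>p\<close> restricted to the sets
  \<open>{\<bar>x\<bar> \<le> k, p \<le> k}\<close>, whose divergence from \<open>p\<close> tends to 0. Thus \<open>m \<le> 0\<close>, and the equality case
  of Gibbs' inequality gives \<open>q = p\<close>.

  For the exact fractional posterior the risk bound is short. Write \<open>a = n \<epsilon>\<^sup>2\<close>, let
  \<open>\<rho>(\<theta>) = exp(-(1 - \<alpha>) D\<^sub>\<alpha>(\<theta>, \<theta>s))\<close> be the affinity and \<open>R(\<theta>)\<close> the likelihood ratio of \<open>\<theta>\<close>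
  to \<open>\<theta>s\<close>. Jensen's inequality bounds the posterior mean of \<open>-ln \<rho>\<close> by the logarithm of
  \<open>\<integral>R\<^sup>\<alpha>/\<rho> d\<pi>\<close> divided by \<open>\<integral>R\<^sup>\<alpha> d\<pi>\<close>. The numerator has expectation at most 1, so it is at most
  \<open>c = (D - 1)\<^sup>2 a\<close> with probability at least \<open>1 - 1/c\<close> (Markov). The denominator is at least
  \<open>exp(-\<alpha> t) \<pi>(B)\<close> with \<open>t = (D - 1) a\<close> whenever the \<open>\<pi>\<close>-average of \<open>(ln R)\<^sup>2\<close> over \<open>B\<close> is at most
  \<open>t\<^sup>2\<close>. That average has expectation at most \<open>a\<close>, by the variance condition in the definition of
  \<open>B\<close>, so Markov's inequality gives the failure probability \<open>a / t\<^sup>2 = 1/c\<close> again.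

  The two estimates yield \<open>ln c + \<alpha> (D - 1) a - ln \<pi>(B)\<close>. Using \<open>t = (D - 1) a\<close> instead of
  \<open>t = D a\<close> leaves the slack \<open>\<alpha> a\<close>, which absorbs the growing term \<open>ln c\<close>, because
  \<open>ln (\<alpha> a) \<le> \<alpha> a - 1\<close>. What remains after division by \<open>n (1 - \<alpha>)\<close> is a multiple of \<open>1/n\<close>
  that depends only on \<open>D\<close> and \<open>\<alpha>\<close>.
\<close>

section \<open>Gaussian mixtures\<close>

lemma gauss_density_eq:
  fixes x :: "real^'d"
  shows "gauss_density \<sigma> x =
    (1 / sqrt (2 * pi * \<sigma>\<^sup>2)) ^ CARD('d) * exp (- (norm x)\<^sup>2 / (2 * \<sigma>\<^sup>2))"
proof -
  have norm: "(norm x)\<^sup>2 = (\<Sum>i\<in>UNIV. (x $ i)\<^sup>2)"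
    unfolding norm_vec_def L2_set_def by (simp add: sum_nonneg)
  have "gauss_density \<sigma> x = (\<Prod>i\<in>(UNIV::'d set). 1 / sqrt (2 * pi * \<sigma>\<^sup>2))
      * (\<Prod>i\<in>UNIV. exp (- (x $ i)\<^sup>2 / (2 * \<sigma>\<^sup>2)))"
    unfolding gauss_density_def normal_density_def by (subst prod.distrib) simp
  also have "(\<Prod>i\<in>UNIV. exp (- (x $ i)\<^sup>2 / (2 * \<sigma>\<^sup>2))) = exp (\<Sum>i\<in>UNIV. - (x $ i)\<^sup>2 / (2 * \<sigma>\<^sup>2))"
    by (simp add: exp_sum)
  also have "(\<Sum>i\<in>UNIV. - (x $ i)\<^sup>2 / (2 * \<sigma>\<^sup>2)) = - (norm x)\<^sup>2 / (2 * \<sigma>\<^sup>2)"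
    unfolding norm by (simp add: sum_negf sum_divide_distrib)
  finally show ?thesis by simp
qed

lemma gauss_density_nonneg: "0 \<le> gauss_density \<sigma> (x :: real^'d)"
  by (auto simp: gauss_density_eq)

lemma continuous_gauss_density: "continuous_on A (gauss_density \<sigma> :: real^'d \<Rightarrow> real)"
  unfolding gauss_density_eq[abs_def] divide_inverse by (intro continuous_intros)

lemma isCont_gauss_density: "isCont (gauss_density \<sigma> :: real^'d \<Rightarrow> real) z"
  unfolding gauss_density_eq[abs_def] divide_inverse by (intro continuous_intros)

lemma measurable_gauss_density[measurable]:
  "(gauss_density \<sigma> :: real^'d \<Rightarrow> real) \<in> borel_measurable borel"
  by (intro borel_measurable_continuous_onI continuous_gauss_density)

lemma gauss_density_le_peak:
  "gauss_density \<sigma> (x :: real^'d) \<le> (1 / sqrt (2 * pi * \<sigma>\<^sup>2)) ^ CARD('d)"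
  unfolding gauss_density_eq by (intro mult_left_le) auto

lemma nn_integral_gauss_density:
  assumes "0 < \<sigma>"
  shows "(\<integral>\<^sup>+ x. ennreal (gauss_density \<sigma> (x - a)) \<partial>(lborel :: (real^'d) measure)) = 1"
proof -
  have B: "Basis = range (\<lambda>i. axis i (1::real) :: real^'d)"
    by (auto simp: Basis_vec_def)
  have inj: "inj (\<lambda>i. axis i (1::real) :: real^'d)"
    by (auto simp: inj_on_def axis_eq_axis)
  have "ennreal (gauss_density \<sigma> (x - a)) =
      (\<Prod>b\<in>Basis. ennreal (normal_density (a \<bullet> b) \<sigma> (x \<bullet> b)))" for x :: "real^'d"
    by (simp add: gauss_density_def B prod.reindex[OF inj] prod_ennreal inner_axis
        normal_density_def)
  then have "(\<integral>\<^sup>+ x. ennreal (gauss_density \<sigma> (x - a)) \<partial>(lborel :: (real^'d) measure)) =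
      (\<Prod>b\<in>(Basis :: (real^'d) set). (\<integral>\<^sup>+ x. ennreal (normal_density (a \<bullet> b) \<sigma> x) \<partial>lborel))"
    by (simp only:)
      (rule nn_integral_lborel_prod[where f = "\<lambda>b x. ennreal (normal_density (a \<bullet> b) \<sigma> x)"], simp_all)
  also have "\<dots> = 1"
  proof (intro prod.neutral ballI)
    fix b :: "real^'d"
    interpret prob_space "density lborel (\<lambda>x. ennreal (normal_density (a \<bullet> b) \<sigma> x))"
      by (rule prob_space_normal_density[OF assms])
    show "(\<integral>\<^sup>+ x. ennreal (normal_density (a \<bullet> b) \<sigma> x) \<partial>lborel) = 1"
      using emeasure_space_1 by (simp add: emeasure_density)
  qed
  finally show ?thesis .
qed

text \<open>
  Location mixtures with an arbitrary mixing space. The choice of \<open>[0,1]\<close> with a path gives the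
  densities of \<open>Q_GP\<close>; a density \<open>g\<close> with the identity map gives the convolution of \<open>g\<close> with a Gaussian.
\<close>

definition gauss_mix :: "'a measure \<Rightarrow> ('a \<Rightarrow> real^'d) \<Rightarrow> real \<Rightarrow> real^'d \<Rightarrow> real" where
  "gauss_mix M \<psi> \<sigma> x = (\<integral>\<eta>. gauss_density \<sigma> (x - \<psi> \<eta>) \<partial>M)"

abbreviation unit_unif :: "real measure" where
  "unit_unif \<equiv> restrict_space lborel {0..1}"

lemma prob_space_unit_unif: "prob_space unit_unif"
  by (rule prob_spaceI) (simp add: emeasure_restrict_space space_restrict_space)

lemma gp_density_eq_gauss_mix: "gp_density \<mu> \<sigma> = gauss_mix unit_unif \<mu> \<sigma>"
  by (rule ext)
    (simp add: gp_density_def gauss_mix_def integral_restrict_space set_lebesgue_integral_def)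

lemma gauss_mix_nonneg: "0 \<le> gauss_mix M \<psi> \<sigma> x"
  unfolding gauss_mix_def by (intro Bochner_Integration.integral_nonneg gauss_density_nonneg)

context finite_measure
begin

lemma integrable_gauss_density_comp:
  assumes [measurable]: "\<psi> \<in> borel_measurable M"
  shows "integrable M (\<lambda>\<eta>. gauss_density \<sigma> (x - \<psi> \<eta> :: real^'d))"
  by (rule integrable_const_bound[where B = "(1 / sqrt (2 * pi * \<sigma>\<^sup>2)) ^ CARD('d)"])
    (auto simp: gauss_density_le_peak gauss_density_nonneg)

lemma measurable_gauss_mix:
  assumes [measurable]: "\<psi> \<in> borel_measurable M"
  shows "(gauss_mix M \<psi> \<sigma> :: real^'d \<Rightarrow> real) \<in> borel_measurable borel"
  unfolding gauss_mix_def[abs_def] by measurable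

lemma ennreal_gauss_mix:
  assumes [measurable]: "\<psi> \<in> borel_measurable M"
  shows "ennreal (gauss_mix M \<psi> \<sigma> (x :: real^'d)) = (\<integral>\<^sup>+\<eta>. gauss_density \<sigma> (x - \<psi> \<eta>) \<partial>M)"
  unfolding gauss_mix_def
  by (rule nn_integral_eq_integral[symmetric])
    (auto intro: integrable_gauss_density_comp simp: gauss_density_nonneg)

lemma nn_integral_gauss_mix:
  assumes [measurable]: "\<psi> \<in> borel_measurable M" and "0 < \<sigma>"
  shows "(\<integral>\<^sup>+x. gauss_mix M \<psi> \<sigma> (x :: real^'d) \<partial>lborel) = emeasure M (space M)"
proof -
  interpret pair_sigma_finite M "lborel :: (real^'d) measure" ..
  have "(\<integral>\<^sup>+x. gauss_mix M \<psi> \<sigma> (x :: real^'d) \<partial>lborel)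
      = (\<integral>\<^sup>+x. (\<integral>\<^sup>+\<eta>. gauss_density \<sigma> (x - \<psi> \<eta> :: real^'d) \<partial>M) \<partial>lborel)"
    by (simp add: ennreal_gauss_mix)
  also have "\<dots> = (\<integral>\<^sup>+\<eta>. (\<integral>\<^sup>+x. gauss_density \<sigma> (x - \<psi> \<eta> :: real^'d) \<partial>lborel) \<partial>M)"
    by (rule Fubini') measurable
  also have "\<dots> = emeasure M (space M)"
    by (simp add: nn_integral_gauss_density \<open>0 < \<sigma>\<close>)
  finally show ?thesis .
qed

lemma gauss_mix_tendsto:
  assumes [measurable]: "\<And>k. s k \<in> borel_measurable M" "\<psi> \<in> borel_measurable M"
    and lim: "AE \<eta> in M. (\<lambda>k. s k \<eta>) \<longlonglongrightarrow> \<psi> \<eta>"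
  shows "(\<lambda>k. gauss_mix M (s k) \<sigma> (x :: real^'d)) \<longlonglongrightarrow> gauss_mix M \<psi> \<sigma> x"
  unfolding gauss_mix_def
proof (rule integral_dominated_convergence[where w = "\<lambda>_. (1 / sqrt (2 * pi * \<sigma>\<^sup>2)) ^ CARD('d)"])
  show "AE \<eta> in M. (\<lambda>k. gauss_density \<sigma> (x - s k \<eta>)) \<longlonglongrightarrow> gauss_density \<sigma> (x - \<psi> \<eta>)"
    using lim
    by (rule eventually_mono)
      (rule isCont_tendsto_compose[OF isCont_gauss_density], rule tendsto_diff[OF tendsto_const])
qed (auto simp: gauss_density_le_peak gauss_density_nonneg)

lemma gauss_mix_le:
  assumes [measurable]: "\<psi> \<in> borel_measurable M"
    and le: "AE \<eta> in M. gauss_density \<sigma> (x - \<psi> \<eta> :: real^'d) \<le> c"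
  shows "gauss_mix M \<psi> \<sigma> x \<le> c * measure M (space M)"
proof -
  have "gauss_mix M \<psi> \<sigma> x \<le> (\<integral>\<eta>. c \<partial>M)"
    unfolding gauss_mix_def using le
    by (intro integral_mono_AE integrable_gauss_density_comp) auto
  then show ?thesis by (simp add: mult.commute)
qed

end

text \<open>
  The path is bounded, so a density in \<open>Q_GP\<close> cannot decay faster than a Gaussian of its own
  bandwidth. This makes a minimizer usable as a dominating density for narrower mixtures.
\<close>

lemma gp_lower_bound:
  fixes \<mu> :: "real \<Rightarrow> real^'d"
  assumes cont: "continuous_on {0..1} \<mu>" and "0 < \<sigma>"
  shows "\<exists>b\<ge>0. \<forall>x. (1 / sqrt (2 * pi * \<sigma>\<^sup>2)) ^ CARD('d) * exp (- (norm x + b)\<^sup>2 / (2 * \<sigma>\<^sup>2))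
      \<le> gp_density \<mu> \<sigma> x"
proof -
  interpret prob_space unit_unif by (rule prob_space_unit_unif)
  have [measurable]: "\<mu> \<in> borel_measurable unit_unif"
    using borel_measurable_continuous_on_restrict[OF cont]
    by (simp add: measurable_cong_sets[OF sets_restrict_space_cong[OF sets_lborel]])
  obtain b where b: "\<And>\<eta>. \<eta> \<in> {0..1} \<Longrightarrow> norm (\<mu> \<eta>) \<le> b"
    using compact_imp_bounded[OF compact_continuous_image[OF cont compact_Icc]]
    unfolding bounded_iff by blast
  have "0 \<le> b" using order_trans[OF norm_ge_zero b[of 0]] by simp
  moreover have "(1 / sqrt (2 * pi * \<sigma>\<^sup>2)) ^ CARD('d) * exp (- (norm x + b)\<^sup>2 / (2 * \<sigma>\<^sup>2))
      \<le> gp_density \<mu> \<sigma> x" for x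
  proof -
    let ?c = "(1 / sqrt (2 * pi * \<sigma>\<^sup>2)) ^ CARD('d) * exp (- (norm x + b)\<^sup>2 / (2 * \<sigma>\<^sup>2))"
    have "?c \<le> gauss_density \<sigma> (x - \<mu> \<eta>)" if "\<eta> \<in> {0..1}" for \<eta>
    proof -
      have "norm (x - \<mu> \<eta>) \<le> norm x + b"
        using b[OF that] norm_triangle_ineq4[of x "\<mu> \<eta>"] by linarith
      then have "(norm (x - \<mu> \<eta>))\<^sup>2 \<le> (norm x + b)\<^sup>2" by (intro power_mono) auto
      then show ?thesis
        unfolding gauss_density_eq using \<open>0 < \<sigma>\<close>
        by (intro mult_left_mono) (auto simp: divide_simps)
    qed
    then have "(\<integral>\<eta>. ?c \<partial>unit_unif) \<le> gauss_mix unit_unif \<mu> \<sigma> x"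
      unfolding gauss_mix_def
      by (intro integral_mono_AE integrable_gauss_density_comp) (auto intro!: AE_I2 simp: space_restrict_space)
    moreover have "(\<integral>\<eta>. ?c \<partial>unit_unif) = ?c"
      by (subst lebesgue_integral_const) (simp only: prob_space scaleR_one)
    ultimately show ?thesis by (simp only: gp_density_eq_gauss_mix)
  qed
  ultimately show ?thesis by blast
qed

lemma Q_GP_facts:
  assumes "q \<in> (Q_GP :: (real^'d \<Rightarrow> real) set)"
  shows "q \<in> borel_measurable borel" "\<And>x. 0 < q x" "(\<integral>\<^sup>+x. q x \<partial>lborel) = 1"
proof -
  interpret prob_space unit_unif by (rule prob_space_unit_unif)
  obtain \<mu> \<sigma> where q: "q = gp_density \<mu> \<sigma>" and \<mu>: "continuous_on {0..1} \<mu>" and \<sigma>: "0 < \<sigma>"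
    using assms by (auto simp: Q_GP_def)
  have [measurable]: "\<mu> \<in> borel_measurable unit_unif"
    using borel_measurable_continuous_on_restrict[OF \<mu>]
    by (simp add: measurable_cong_sets[OF sets_restrict_space_cong[OF sets_lborel]])
  show "q \<in> borel_measurable borel"
    unfolding q gp_density_eq_gauss_mix by (rule measurable_gauss_mix) simp
  show "(\<integral>\<^sup>+x. q x \<partial>lborel) = 1"
    unfolding q gp_density_eq_gauss_mix
    by (subst nn_integral_gauss_mix) (use \<sigma> emeasure_space_1 in auto)
  show "0 < q x" for x
  proof -
    obtain b where "(1 / sqrt (2 * pi * \<sigma>\<^sup>2)) ^ CARD('d) * exp (- (norm x + b)\<^sup>2 / (2 * \<sigma>\<^sup>2)) \<le> q x"
      using gp_lower_bound[OF \<mu> \<sigma>] q by auto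
    moreover have "0 < (1 / sqrt (2 * pi * \<sigma>\<^sup>2)) ^ CARD('d) * exp (- (norm x + b)\<^sup>2 / (2 * \<sigma>\<^sup>2))"
      using \<sigma> by simp
    ultimately show ?thesis by linarith
  qed
qed

section \<open>Relative entropy along dominated sequences\<close>

lemma abs_x_ln_x_le:
  fixes t :: real
  assumes "0 \<le> t"
  shows "\<bar>t * ln t\<bar> \<le> 1 + t\<^sup>2"
proof (cases "t = 0")
  case False
  then have "0 < t" using assms by simp
  have "t * ln t \<le> t * (t - 1)"
    using \<open>0 < t\<close> ln_le_minus_one[of t] by (intro mult_left_mono) auto
  moreover have "t * (- ln t) \<le> t * (1 / t - 1)"
    using \<open>0 < t\<close> ln_le_minus_one[of "1 / t"] by (intro mult_left_mono) (auto simp: ln_div)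
  ultimately have "t * ln t \<le> t * t - t" "- (t * ln t) \<le> 1 - t"
    using \<open>0 < t\<close> by (auto simp: algebra_simps)
  moreover have "0 \<le> t * t" by simp
  ultimately show ?thesis
    using \<open>0 < t\<close> unfolding abs_le_iff power2_eq_square by linarith
qed simp

lemma abs_x_ln_x_le_sqrt:
  fixes t :: real
  assumes "0 \<le> t" "t \<le> 1"
  shows "\<bar>t * ln t\<bar> \<le> 2 * sqrt t"
proof (cases "t = 0")
  case False
  then have "0 < t" using assms by simp
  have "- ln t = 2 * ln (1 / sqrt t)"
    using \<open>0 < t\<close> by (simp add: ln_div ln_sqrt)
  also have "\<dots> \<le> 2 * (1 / sqrt t - 1)"
    using \<open>0 < t\<close> ln_le_minus_one[of "1 / sqrt t"] by simp
  also have "\<dots> \<le> 2 / sqrt t" by simp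
  finally have "t * (- ln t) \<le> t * (2 / sqrt t)"
    using \<open>0 < t\<close> by (intro mult_left_mono) auto
  also have "\<dots> = 2 * sqrt t" using \<open>0 < t\<close> by (simp add: field_simps)
  finally show ?thesis
    using \<open>0 < t\<close> assms by (simp add: abs_mult)
qed simp

text \<open>
  The case of a vanishing limit is the content: \<open>\<bar>t ln t\<bar> \<le> 2 \<surd>t\<close> on \<open>[0,1]\<close>.
\<close>

lemma tendsto_x_ln_x:
  fixes a :: "nat \<Rightarrow> real"
  assumes nn: "\<And>k. 0 \<le> a k" and lim: "a \<longlonglongrightarrow> l"
  shows "(\<lambda>k. a k * ln (a k)) \<longlonglongrightarrow> l * ln l"
proof (cases "l = 0")
  case False
  then show ?thesis using lim by (intro tendsto_intros) auto
next
  case True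
  have "(\<lambda>k. a k * ln (a k)) \<longlonglongrightarrow> 0"
  proof (rule Lim_null_comparison)
    have "\<forall>\<^sub>F k in sequentially. a k < 1"
      using lim True by (intro order_tendstoD) auto
    then show "\<forall>\<^sub>F k in sequentially. norm (a k * ln (a k)) \<le> 2 * sqrt (a k)"
      by eventually_elim (use nn abs_x_ln_x_le_sqrt in auto)
    show "(\<lambda>k. 2 * sqrt (a k)) \<longlonglongrightarrow> 0"
      using tendsto_mult[OF tendsto_const[of 2] tendsto_real_sqrt[OF lim]] True by simp
  qed
  then show ?thesis using True by simp
qed

text \<open>
  A fully supported law \<open>q\<close> at finite divergence from \<open>p\<close>. It serves as the reference measure
  for all other divergences from \<open>p\<close>.
\<close>

locale kl_reference =
  fixes q p :: "'a::euclidean_space \<Rightarrow> real"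
  assumes q_meas[measurable]: "q \<in> borel_measurable borel"
    and p_meas[measurable]: "p \<in> borel_measurable borel"
    and q_pos: "\<And>x. 0 < q x"
    and p_pos: "AE x in lborel. 0 < p x"
    and q_int: "integrable lborel q"
    and kl_int: "integrable lborel (\<lambda>x. q x * ln (q x / p x))"
begin

text \<open>
  For \<open>g\<close> of total mass \<open>I > 0\<close> this is \<open>I (KL(g / I \<parallel> p) - m)\<close>. The homogeneous form spares the
  normalisation of every approximating function, and it has no singularity at \<open>I = 0\<close>.
\<close>

definition kl_gap :: "real \<Rightarrow> ('a \<Rightarrow> real) \<Rightarrow> real" where
  "kl_gap m g = (\<integral>x. g x * ln (g x / p x) \<partial>lborel)
     - (\<integral>x. g x \<partial>lborel) * ln (\<integral>x. g x \<partial>lborel) - m * (\<integral>x. g x \<partial>lborel)"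

text \<open>
  The change of reference measure from Lebesgue measure to \<open>q\<close>, with density ratio \<open>u = g / q\<close>:
  \<open>g ln (g / p) = q (u ln u) + u (q ln (q / p))\<close>. If \<open>u\<close> is bounded, the first summand is a bounded
  multiple of \<open>q\<close> and the second one a bounded multiple of an integrable function.
\<close>

lemma kl_integrand_eq:
  assumes "0 < p x" "0 \<le> g x"
  shows "g x * ln (g x / p x)
    = q x * ((g x / q x) * ln (g x / q x)) + (g x / q x) * (q x * ln (q x / p x))"
  using assms q_pos[of x]
  by (cases "g x = 0") (auto simp: ln_div algebra_simps)

lemma kl_integrand_bound:
  assumes "0 < p x" "0 \<le> g x" "g x \<le> C * q x"
  shows "\<bar>g x * ln (g x / p x)\<bar> \<le> (1 + C\<^sup>2) * q x + C * \<bar>q x * ln (q x / p x)\<bar>"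
proof -
  let ?u = "g x / q x"
  have u: "0 \<le> ?u" "?u \<le> C"
    using assms q_pos[of x] by (auto simp: divide_simps)
  have "\<bar>?u * ln ?u\<bar> \<le> 1 + C\<^sup>2"
    using abs_x_ln_x_le[OF u(1)] power_mono[OF u(2) u(1), of 2] by linarith
  then have "\<bar>q x * (?u * ln ?u)\<bar> \<le> q x * (1 + C\<^sup>2)"
    using q_pos[of x] unfolding abs_mult[of "q x"] by (intro mult_mono) auto
  moreover have "\<bar>?u * (q x * ln (q x / p x))\<bar> \<le> C * \<bar>q x * ln (q x / p x)\<bar>"
    using u unfolding abs_mult[of ?u] by (intro mult_right_mono) auto
  ultimately show ?thesis
    unfolding kl_integrand_eq[of x g, OF assms(1,2)] by (simp add: mult.commute)
qed

lemma integrable_dominated: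
  assumes [measurable]: "g \<in> borel_measurable borel"
    and "\<And>x. 0 \<le> g x" "\<And>x. g x \<le> C * q x"
  shows "integrable lborel g" "integrable lborel (\<lambda>x. g x * ln (g x / p x))"
proof -
  show "integrable lborel g"
  proof (rule Bochner_Integration.integrable_bound)
    show "integrable lborel (\<lambda>x. C * q x)" using q_int by simp
    show "AE x in lborel. norm (g x) \<le> norm (C * q x)"
    proof (rule AE_I2)
      fix x show "norm (g x) \<le> norm (C * q x)" using assms(2,3)[of x] by simp
    qed
  qed simp
  show "integrable lborel (\<lambda>x. g x * ln (g x / p x))"
  proof (rule Bochner_Integration.integrable_bound)
    show "integrable lborel (\<lambda>x. (1 + C\<^sup>2) * q x + C * \<bar>q x * ln (q x / p x)\<bar>)"
      using q_int kl_int by auto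
    show "AE x in lborel. norm (g x * ln (g x / p x))
        \<le> norm ((1 + C\<^sup>2) * q x + C * \<bar>q x * ln (q x / p x)\<bar>)"
      using p_pos
    proof eventually_elim
      case (elim x)
      show ?case
        using kl_integrand_bound[of x g C] elim assms(2,3)[of x] by (auto simp del: abs_mult)
    qed
  qed simp
qed

lemma kl_gap_tendsto:
  assumes [measurable]: "\<And>k. g k \<in> borel_measurable borel" "h \<in> borel_measurable borel"
    and nn: "\<And>k x. 0 \<le> g k x" and dom: "\<And>k x. g k x \<le> C * q x"
    and lim: "AE x in lborel. (\<lambda>k. g k x) \<longlonglongrightarrow> h x"
  shows "(\<lambda>k. kl_gap m (g k)) \<longlonglongrightarrow> kl_gap m h"
proof -
  have int: "(\<lambda>k. \<integral>x. g k x \<partial>lborel) \<longlonglongrightarrow> (\<integral>x. h x \<partial>lborel)"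
  proof (rule integral_dominated_convergence[where w = "\<lambda>x. C * q x"])
    show "AE x in lborel. norm (g k x) \<le> C * q x" for k using nn dom by auto
  qed (use lim q_int in auto)
  have "(\<lambda>k. \<integral>x. g k x * ln (g k x / p x) \<partial>lborel) \<longlonglongrightarrow> (\<integral>x. h x * ln (h x / p x) \<partial>lborel)"
  proof (rule integral_dominated_convergence
      [where w = "\<lambda>x. (1 + C\<^sup>2) * q x + C * \<bar>q x * ln (q x / p x)\<bar>"])
    show "AE x in lborel. norm (g k x * ln (g k x / p x))
        \<le> (1 + C\<^sup>2) * q x + C * \<bar>q x * ln (q x / p x)\<bar>" for k
      using p_pos
    proof eventually_elim
      case (elim x)
      show ?case
        using kl_integrand_bound[of x "g k" C] elim nn dom by auto
    qed
    show "AE x in lborel. (\<lambda>k. g k x * ln (g k x / p x)) \<longlonglongrightarrow> h x * ln (h x / p x)"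
      using p_pos lim
    proof eventually_elim
      case (elim x)
      have hx: "0 \<le> h x" by (rule LIMSEQ_le_const[OF elim(2)]) (use nn in auto)
      have eq: "t * ln (t / p x) = t * ln t - t * ln (p x)" if "0 \<le> t" for t
        using elim(1) that by (cases "t = 0") (auto simp: ln_div algebra_simps)
      show ?case
        unfolding eq[OF nn] eq[OF hx]
        using tendsto_diff[OF tendsto_x_ln_x[of "\<lambda>k. g k x"] tendsto_mult_right[of _ _ _ "ln (p x)"], OF nn elim(2) elim(2)]
        by simp
    qed
  qed (use q_int kl_int in auto)
  moreover have "(\<lambda>k. (\<integral>x. g k x \<partial>lborel) * ln (\<integral>x. g k x \<partial>lborel))
      \<longlonglongrightarrow> (\<integral>x. h x \<partial>lborel) * ln (\<integral>x. h x \<partial>lborel)"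
    by (rule tendsto_x_ln_x[OF _ int]) (simp add: nn)
  ultimately show ?thesis
    unfolding kl_gap_def by (intro tendsto_diff tendsto_mult_left int)
qed

text \<open>
  The closure property on which the approximation argument rests: a lower bound \<open>m\<close> for the divergence
  from \<open>p\<close> is inherited by limits of functions dominated by a multiple of \<open>q\<close>.
\<close>

lemma kl_gap_nonneg_limit:
  assumes "\<And>k. g k \<in> borel_measurable borel" "h \<in> borel_measurable borel"
    and "\<And>k x. 0 \<le> g k x" "\<And>k x. g k x \<le> C * q x"
    and "AE x in lborel. (\<lambda>k. g k x) \<longlonglongrightarrow> h x"
    and gap: "\<And>k. 0 \<le> kl_gap m (g k)"
  shows "0 \<le> kl_gap m h"
  by (rule LIMSEQ_le_const[OF kl_gap_tendsto[of g h C, OF assms(1-5)]]) (use gap in auto)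

lemma kl_gap_scale:
  assumes "0 \<le> c" and g: "\<And>x. 0 \<le> g x" "\<And>x. g x \<le> C * q x" "g \<in> borel_measurable borel"
    and mass: "(\<integral>x. g x \<partial>lborel) = 1"
  shows "kl_gap m (\<lambda>x. c * g x) = c * kl_gap m g"
proof (cases "c = 0")
  case True
  then show ?thesis by (simp add: kl_gap_def)
next
  case False
  then have c: "0 < c" using assms by simp
  have "(\<integral>x. c * g x * ln (c * g x / p x) \<partial>lborel)
      = (\<integral>x. c * (g x * ln (g x / p x)) + c * ln c * g x \<partial>lborel)"
  proof (rule integral_cong_AE)
    show "AE x in lborel. c * g x * ln (c * g x / p x) = c * (g x * ln (g x / p x)) + c * ln c * g x"
      using p_pos
    proof eventually_elim
      case (elim x)
      then show ?case
        using c g(1)[of x] by (cases "g x = 0") (auto simp: ln_div ln_mult algebra_simps)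
    qed
  qed (use g(3) in measurable)
  also have "\<dots> = c * (\<integral>x. g x * ln (g x / p x) \<partial>lborel) + c * ln c * (\<integral>x. g x \<partial>lborel)"
    using integrable_dominated[OF g(3,1,2)] by simp
  finally show ?thesis
    by (simp add: kl_gap_def mass algebra_simps)
qed

end

section \<open>Discrete laws as images of the uniform law\<close>

lemma power_le_fact_exp:
  fixes u :: real
  assumes "0 \<le> u"
  shows "u ^ n \<le> fact n * exp u"
proof -
  have "(\<Sum>k\<in>{n}. u ^ k /\<^sub>R fact k) \<le> exp u"
    unfolding exp_def using assms summable_exp_generic[of u]
    by (intro sum_le_suminf) auto
  then show ?thesis by (simp add: field_simps)
qed

text \<open>
  A form of Lusin's theorem. It replaces measurable paths by continuous ones, and measurable
  densities by continuous ones.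
\<close>

lemma continuous_approx_AE:
  fixes \<psi> :: "'a::euclidean_space \<Rightarrow> 'b::euclidean_space"
  assumes "\<psi> \<in> borel_measurable borel"
  shows "\<exists>g. (\<forall>k. continuous_on UNIV (g k)) \<and> (AE x in lborel. (\<lambda>k. g k x) \<longlonglongrightarrow> \<psi> x)"
proof -
  have "\<psi> \<in> borel_measurable lebesgue"
    using assms by (intro measurable_completion) simp
  then have "\<psi> measurable_on UNIV"
    by (rule lebesgue_measurable_imp_measurable_on) simp
  then obtain N g where "negligible N" and g: "\<And>k. continuous_on UNIV (g k)"
    and lim: "\<And>x. x \<notin> N \<Longrightarrow> (\<lambda>k. g k x) \<longlonglongrightarrow> \<psi> x"
    unfolding measurable_on_def by auto
  then have "N \<in> null_sets lebesgue" by (simp add: negligible_iff_null_sets)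
  then have "AE x in lebesgue. x \<notin> N" by (rule AE_not_in)
  then have "AE x in lborel. x \<notin> N" by (simp add: AE_completion_iff)
  then have "AE x in lborel. (\<lambda>k. g k x) \<longlonglongrightarrow> \<psi> x"
    by eventually_elim (rule lim)
  with g show ?thesis by blast
qed

text \<open>
  The map takes the value \<open>v\<close> on an interval of length \<open>w v\<close>; the intervals for the points of \<open>V\<close> are
  laid end to end from 0. To the left of 0 it takes the auxiliary value \<open>a\<close>.
\<close>

lemma finite_law_as_step_map:
  fixes w :: "'b::topological_space \<Rightarrow> real"
  assumes "finite V" and "\<And>v. 0 \<le> w v"
  shows "\<exists>\<psi>::real \<Rightarrow> 'b. \<psi> \<in> borel_measurable borel \<and> (\<forall>\<eta>. \<psi> \<eta> \<in> insert a V) \<and>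
    (\<forall>h::'b \<Rightarrow> ennreal. h \<in> borel_measurable borel \<longrightarrow>
      (\<integral>\<^sup>+\<eta>. h (\<psi> \<eta>) * indicator {0..<sum w V} \<eta> \<partial>lborel) = (\<Sum>v\<in>V. ennreal (w v) * h v))"
  using assms(1)
proof (induction V)
  case empty
  show ?case by (rule exI[of _ "\<lambda>_. a"]) simp
next
  case (insert v V)
  then obtain \<psi> where [measurable]: "\<psi> \<in> borel_measurable borel"
    and ran: "\<And>\<eta>. \<psi> \<eta> \<in> insert a V"
    and int: "\<And>h::'b \<Rightarrow> ennreal. h \<in> borel_measurable borel \<Longrightarrow>
      (\<integral>\<^sup>+\<eta>. h (\<psi> \<eta>) * indicator {0..<sum w V} \<eta> \<partial>lborel) = (\<Sum>v\<in>V. ennreal (w v) * h v)"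
    by auto
  let ?W = "sum w V"
  have W: "0 \<le> ?W" by (intro sum_nonneg assms)
  let ?\<psi> = "\<lambda>\<eta>. if \<eta> < ?W then \<psi> \<eta> else v"
  have [measurable]: "?\<psi> \<in> borel_measurable borel" by measurable
  have "(\<integral>\<^sup>+\<eta>. h (?\<psi> \<eta>) * indicator {0..<sum w (insert v V)} \<eta> \<partial>lborel)
      = (\<Sum>v\<in>insert v V. ennreal (w v) * h v)"
    if [measurable]: "h \<in> borel_measurable borel" for h :: "'b \<Rightarrow> ennreal"
  proof -
    have sum: "sum w (insert v V) = w v + ?W" using insert by simp
    have "(\<integral>\<^sup>+\<eta>. h (?\<psi> \<eta>) * indicator {0..<sum w (insert v V)} \<eta> \<partial>lborel)
      = (\<integral>\<^sup>+\<eta>. h (\<psi> \<eta>) * indicator {0..<?W} \<eta> + h v * indicator {?W..<w v + ?W} \<eta> \<partial>lborel)"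
      unfolding sum using W assms(2)[of v]
      by (intro nn_integral_cong) (auto simp: indicator_def)
    also have "\<dots> = (\<integral>\<^sup>+\<eta>. h (\<psi> \<eta>) * indicator {0..<?W} \<eta> \<partial>lborel) + h v * ennreal (w v)"
      using assms(2)[of v] by (subst nn_integral_add) (auto simp: nn_integral_cmult_indicator)
    finally show ?thesis
      using insert by (simp add: int mult.commute add.commute)
  qed
  then show ?case
    using ran by (intro exI[of _ ?\<psi>]) auto
qed

lemma simple_law_as_map_of_uniform:
  fixes s :: "'a \<Rightarrow> real^'d"
  assumes "finite_measure M" and s: "simple_function M s"
    and bound: "\<And>y. y \<in> space M \<Longrightarrow> norm (s y) \<le> R" and "0 \<le> R"
  shows "\<exists>\<psi> \<in> borel_measurable unit_unif. (\<forall>\<eta>. norm (\<psi> \<eta>) \<le> R) \<and>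
    (\<forall>\<sigma> x. gauss_mix M s \<sigma> x = measure M (space M) * gauss_mix unit_unif \<psi> \<sigma> x)"
proof -
  interpret finite_measure M by fact
  interpret U: prob_space unit_unif by (rule prob_space_unit_unif)
  let ?V = "s ` space M" and ?c = "measure M (space M)"
  have fin: "finite ?V" using s by (simp add: simple_function_def)
  have [measurable]: "s \<in> borel_measurable M" using s by (rule borel_measurable_simple_function)
  have lvl: "s -` {v} \<inter> space M \<in> sets M" for v using s by (rule simple_functionD)
  let ?w = "\<lambda>v. measure M (s -` {v} \<inter> space M) / ?c"
  have [simp]: "0 \<le> ?w v" for v by simp
  obtain \<psi> where \<psi>[measurable]: "\<psi> \<in> borel_measurable borel"
    and ran: "\<And>\<eta>. \<psi> \<eta> \<in> insert 0 ?V"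
    and int: "\<And>h::real^'d \<Rightarrow> ennreal. h \<in> borel_measurable borel \<Longrightarrow>
      (\<integral>\<^sup>+\<eta>. h (\<psi> \<eta>) * indicator {0..<sum ?w ?V} \<eta> \<partial>lborel) = (\<Sum>v\<in>?V. ennreal (?w v) * h v)"
    using finite_law_as_step_map[OF fin, of ?w 0] by auto
  have \<psi>U: "\<psi> \<in> borel_measurable unit_unif"
    by (intro measurable_restrict_space1) simp
  have tot: "(\<Sum>v\<in>?V. measure M (s -` {v} \<inter> space M)) = ?c"
  proof -
    have "(\<Sum>v\<in>?V. measure M (s -` {v} \<inter> space M)) = measure M (\<Union>v\<in>?V. s -` {v} \<inter> space M)"
      by (rule finite_measure_finite_Union[symmetric, OF fin])
        (use lvl in \<open>auto simp: disjoint_family_on_def\<close>)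
    also have "(\<Union>v\<in>?V. s -` {v} \<inter> space M) = space M" by auto
    finally show ?thesis .
  qed
  have "gauss_mix M s \<sigma> x = ?c * gauss_mix unit_unif \<psi> \<sigma> x" for \<sigma> x
  proof (cases "?c = 0")
    case True
    then have "space M \<in> null_sets M" by (simp add: null_sets_def emeasure_eq_measure)
    then have "AE y in M. False" by (auto dest: AE_not_in elim: AE_mp)
    then have "gauss_mix M s \<sigma> x = 0"
      unfolding gauss_mix_def by (subst integral_cong_AE[where g = "\<lambda>_. 0"]) auto
    then show ?thesis using True by simp
  next
    case False
    then have c: "0 < ?c" by (simp add: zero_less_measure_iff)
    have W: "sum ?w ?V = 1" using False by (simp add: sum_divide_distrib[symmetric] tot)
    let ?h = "\<lambda>v. ennreal (gauss_density \<sigma> (x - v))"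
    have "ennreal (gauss_mix unit_unif \<psi> \<sigma> x) = (\<integral>\<^sup>+\<eta>. ?h (\<psi> \<eta>) * indicator {0..1} \<eta> \<partial>lborel)"
      unfolding U.ennreal_gauss_mix[OF \<psi>U] by (subst nn_integral_restrict_space) auto
    also have "\<dots> = (\<integral>\<^sup>+\<eta>. ?h (\<psi> \<eta>) * indicator {0..<sum ?w ?V} \<eta> \<partial>lborel)"
      unfolding W using AE_lborel_singleton[of "1::real"]
      by (intro nn_integral_cong_AE) (auto elim!: eventually_mono simp: indicator_def)
    also have "\<dots> = (\<Sum>v\<in>?V. ennreal (?w v) * ?h v)"
      by (rule int) simp
    finally have "ennreal (?c * gauss_mix unit_unif \<psi> \<sigma> x) = ennreal ?c * (\<Sum>v\<in>?V. ennreal (?w v) * ?h v)"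
      by (simp add: ennreal_mult' gauss_mix_nonneg)
    also have "\<dots> = (\<Sum>v\<in>?V. ?h v * emeasure M (s -` {v} \<inter> space M))"
      using c by (simp add: sum_distrib_left emeasure_eq_measure ennreal_mult'[symmetric] ennreal_mult''[symmetric] gauss_density_nonneg mult_ac)
    also have "\<dots> = (\<Sum>v\<in>?V. (\<integral>\<^sup>+y. ?h v * indicator (s -` {v} \<inter> space M) y \<partial>M))"
      using lvl by (simp add: nn_integral_cmult_indicator)
    also have "\<dots> = (\<integral>\<^sup>+y. (\<Sum>v\<in>?V. ?h v * indicator (s -` {v} \<inter> space M) y) \<partial>M)"
      using lvl by (subst nn_integral_sum) auto
    also have "\<dots> = (\<integral>\<^sup>+y. ?h (s y) \<partial>M)"
    proof (rule nn_integral_cong)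
      fix y assume y: "y \<in> space M"
      have "(\<Sum>v\<in>?V. ?h v * indicator (s -` {v} \<inter> space M) y) = (\<Sum>v\<in>?V. if v = s y then ?h v else 0)"
        using y by (intro sum.cong) (auto simp: indicator_def)
      then show "(\<Sum>v\<in>?V. ?h v * indicator (s -` {v} \<inter> space M) y) = ?h (s y)"
        using fin y by (simp add: sum.delta)
    qed
    also have "\<dots> = ennreal (gauss_mix M s \<sigma> x)"
      by (simp add: ennreal_gauss_mix)
    finally show ?thesis
      by (simp add: gauss_mix_nonneg)
  qed
  moreover have "norm (\<psi> \<eta>) \<le> R" for \<eta>
    using ran[of \<eta>] bound \<open>0 \<le> R\<close> by auto
  ultimately show ?thesis using \<psi>U by blast
qed

section \<open>An attained minimum over Gaussian mixtures equals its target\<close>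

text \<open>
  The substitution \<open>y = x + \<sigma> z\<close>; in this form the limit \<open>\<sigma> \<rightarrow> 0\<close> can be taken under the integral.
\<close>

lemma gauss_mix_convolution:
  fixes g :: "real^'d \<Rightarrow> real"
  assumes [measurable]: "g \<in> borel_measurable borel" and "\<And>x. 0 \<le> g x" and "0 < \<sigma>"
  shows "gauss_mix (density lborel g) (\<lambda>y. y) \<sigma> x = (\<integral>z. g (x + \<sigma> *\<^sub>R z) * gauss_density 1 z \<partial>lborel)"
proof -
  have scale: "\<sigma> ^ CARD('d) * gauss_density \<sigma> (- \<sigma> *\<^sub>R z) = gauss_density 1 z" for z :: "real^'d"
  proof -
    have "\<sigma> ^ CARD('d) * (1 / sqrt (2 * pi * \<sigma>\<^sup>2)) ^ CARD('d) = (1 / sqrt (2 * pi)) ^ CARD('d)"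
      unfolding power_mult_distrib[symmetric] using \<open>0 < \<sigma>\<close> by (simp add: real_sqrt_mult)
    then show ?thesis
      using \<open>0 < \<sigma>\<close> unfolding gauss_density_eq mult.assoc[symmetric]
      by (simp add: power_mult_distrib)
  qed
  have "gauss_mix (density lborel g) (\<lambda>y. y) \<sigma> x = (\<integral>y. g y * gauss_density \<sigma> (x - y) \<partial>lborel)"
    unfolding gauss_mix_def using assms(2) by (subst integral_density) auto
  also have "\<dots> = (\<integral>y. g y * gauss_density \<sigma> (x - y)
      \<partial>density (distr lborel borel (\<lambda>z. x + \<sigma> *\<^sub>R z)) (\<lambda>_. ennreal (\<bar>\<sigma>\<bar> ^ DIM(real^'d))))"
    using \<open>0 < \<sigma>\<close> by (subst lborel_affine[of \<sigma> x]) (auto simp: ennreal_power)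
  also have "\<dots> = (\<integral>z. \<sigma> ^ CARD('d) * (g (x + \<sigma> *\<^sub>R z) * gauss_density \<sigma> (x - (x + \<sigma> *\<^sub>R z))) \<partial>lborel)"
    using \<open>0 < \<sigma>\<close> by (subst integral_density) (auto simp: integral_distr)
  also have "\<dots> = (\<integral>z. g (x + \<sigma> *\<^sub>R z) * gauss_density 1 z \<partial>lborel)"
    by (simp add: scale[symmetric] mult_ac)
  finally show ?thesis .
qed

text \<open>
  The lower bound \<open>m\<close> is required only for members of the family that are dominated by \<open>q\<close>, since their
  divergence from \<open>p\<close> is a convergent integral.
\<close>

locale gp_minimizer = kl_reference q p for q p :: "real^'d \<Rightarrow> real" +
  fixes m :: real
  assumes q_gp: "q \<in> Q_GP"
    and m_min: "\<And>g C. g \<in> Q_GP \<Longrightarrow> (\<And>x. g x \<le> C * q x) \<Longrightarrow>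
      m \<le> (\<integral>x. g x * ln (g x / p x) \<partial>lborel)"
begin

text \<open>
  With \<open>s = \<bar>x - y\<bar>\<close> and \<open>b\<close> a bound for the path of \<open>q\<close>, the Gaussian lower bound of \<open>q\<close> at \<open>x\<close> has exponent at most
  \<open>(s + R + b)\<^sup>2 / (2 \<tau>\<^sup>2) \<le> s\<^sup>2 / \<tau>\<^sup>2 + (R + b)\<^sup>2 / \<tau>\<^sup>2\<close>, where \<open>\<tau>\<close> is the bandwidth of \<open>q\<close>.
\<close>

lemma gauss_tail_dominated:
  shows "\<exists>\<tau>>0. \<forall>R\<ge>0. \<exists>C\<ge>0. \<forall>x y. norm y \<le> R \<longrightarrow> exp (- (norm (x - y))\<^sup>2 / \<tau>\<^sup>2) \<le> C * q x"
proof -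
  obtain \<mu> \<tau> where q: "q = gp_density \<mu> \<tau>" and \<mu>: "continuous_on {0..1} \<mu>" and \<tau>: "0 < \<tau>"
    using q_gp by (auto simp: Q_GP_def)
  define K where "K = (1 / sqrt (2 * pi * \<tau>\<^sup>2)) ^ CARD('d)"
  have K: "0 < K" unfolding K_def using \<tau> by simp
  obtain b where "0 \<le> b" and low: "\<And>x. K * exp (- (norm x + b)\<^sup>2 / (2 * \<tau>\<^sup>2)) \<le> q x"
    using gp_lower_bound[OF \<mu> \<tau>] unfolding q K_def by blast
  have "\<exists>C\<ge>0. \<forall>x y. norm y \<le> R \<longrightarrow> exp (- (norm (x - y))\<^sup>2 / \<tau>\<^sup>2) \<le> C * q x" if "0 \<le> R" for R
  proof (intro exI[of _ "exp ((R + b)\<^sup>2 / \<tau>\<^sup>2) / K"] conjI allI impI)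
    show "0 \<le> exp ((R + b)\<^sup>2 / \<tau>\<^sup>2) / K" using K by simp
    fix x y :: "real^'d" assume "norm y \<le> R"
    let ?s = "norm (x - y)"
    have "norm x + b \<le> ?s + (R + b)"
      using norm_triangle_sub[of x y] \<open>norm y \<le> R\<close> by linarith
    then have "(norm x + b)\<^sup>2 \<le> (?s + (R + b))\<^sup>2" using \<open>0 \<le> b\<close> by (intro power_mono) auto
    also have "\<dots> \<le> 2 * ?s\<^sup>2 + 2 * (R + b)\<^sup>2"
      using zero_le_power2[of "?s - (R + b)"] by (simp add: power2_eq_square algebra_simps)
    finally have "(norm x + b)\<^sup>2 / (2 * \<tau>\<^sup>2) \<le> (2 * ?s\<^sup>2 + 2 * (R + b)\<^sup>2) / (2 * \<tau>\<^sup>2)"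
      by (intro divide_right_mono) auto
    also have "\<dots> = ?s\<^sup>2 / \<tau>\<^sup>2 + (R + b)\<^sup>2 / \<tau>\<^sup>2"
      using \<tau> by (simp add: field_simps)
    finally have "- ?s\<^sup>2 / \<tau>\<^sup>2 \<le> (R + b)\<^sup>2 / \<tau>\<^sup>2 + (- (norm x + b)\<^sup>2 / (2 * \<tau>\<^sup>2))" by simp
    then have "exp (- ?s\<^sup>2 / \<tau>\<^sup>2) \<le> exp ((R + b)\<^sup>2 / \<tau>\<^sup>2) * exp (- (norm x + b)\<^sup>2 / (2 * \<tau>\<^sup>2))"
      unfolding exp_add[symmetric] by simp
    also have "\<dots> \<le> exp ((R + b)\<^sup>2 / \<tau>\<^sup>2) * (q x / K)"
      using low[of x] K by (intro mult_left_mono) (auto simp: field_simps)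
    finally show "exp (- ?s\<^sup>2 / \<tau>\<^sup>2) \<le> exp ((R + b)\<^sup>2 / \<tau>\<^sup>2) / K * q x" by simp
  qed
  with \<tau> show ?thesis by blast
qed

text \<open>
  A scale for Gaussian tails that \<open>q\<close> dominates, such as the bandwidth of \<open>q\<close>. All later bandwidths are
  measured against it.
\<close>

definition tail_scale :: real where
  "tail_scale = (SOME \<tau>. 0 < \<tau> \<and>
    (\<forall>R\<ge>0. \<exists>C\<ge>0. \<forall>x y. norm y \<le> R \<longrightarrow> exp (- (norm (x - y))\<^sup>2 / \<tau>\<^sup>2) \<le> C * q x))"

lemma tail_scale_pos: "0 < tail_scale"
  and tail_dominated: "0 \<le> R \<Longrightarrow>
    \<exists>C\<ge>0. \<forall>x y. norm y \<le> R \<longrightarrow> exp (- (norm (x - y))\<^sup>2 / tail_scale\<^sup>2) \<le> C * q x"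
  unfolding tail_scale_def using someI_ex[OF gauss_tail_dominated] by blast+

text \<open>
  At bandwidths up to half the tail scale, half of the exponent \<open>z\<^sup>2 / (2 \<sigma>\<^sup>2)\<close> already yields the tail
  factor. The other half is kept to offset the growth of the peak as \<open>\<sigma> \<rightarrow> 0\<close>.
\<close>

lemma gauss_density_split:
  assumes "0 < \<sigma>" "\<sigma> \<le> tail_scale / 2"
  shows "gauss_density \<sigma> (z :: real^'d)
    \<le> (1 / \<sigma>) ^ CARD('d) * exp (- (norm z)\<^sup>2 / (4 * \<sigma>\<^sup>2)) * exp (- (norm z)\<^sup>2 / tail_scale\<^sup>2)"
proof -
  have "sqrt (2 * pi * \<sigma>\<^sup>2) \<ge> sqrt (\<sigma>\<^sup>2)"
    using pi_ge_two by (intro real_sqrt_le_mono mult_left_le_one_le[THEN order_trans] ) (auto simp: mult_le_cancel_right1)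
  then have "(1 / sqrt (2 * pi * \<sigma>\<^sup>2)) ^ CARD('d) \<le> (1 / \<sigma>) ^ CARD('d)"
    using assms by (intro power_mono divide_left_mono) auto
  moreover have "exp (- (norm z)\<^sup>2 / (2 * \<sigma>\<^sup>2))
      \<le> exp (- (norm z)\<^sup>2 / (4 * \<sigma>\<^sup>2)) * exp (- (norm z)\<^sup>2 / tail_scale\<^sup>2)"
  proof -
    have "4 * \<sigma>\<^sup>2 \<le> tail_scale\<^sup>2"
      using power_mono[OF assms(2), of 2] assms(1) by (simp add: power_divide)
    then have "(norm z)\<^sup>2 / tail_scale\<^sup>2 \<le> (norm z)\<^sup>2 / (4 * \<sigma>\<^sup>2)"
      using assms(1) by (intro divide_left_mono) (auto intro!: mult_pos_pos tail_scale_pos)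
    then show ?thesis unfolding exp_add[symmetric] by (simp add: field_simps)
  qed
  ultimately show ?thesis
    unfolding gauss_density_eq mult.assoc using assms(1) by (intro mult_mono) auto
qed

lemma gauss_density_dominated:
  assumes "0 < \<sigma>" "\<sigma> \<le> tail_scale / 2" "0 \<le> R"
  shows "\<exists>C\<ge>0. \<forall>x y. norm y \<le> R \<longrightarrow> gauss_density \<sigma> (x - y) \<le> C * q x"
proof -
  obtain C where C: "0 \<le> C" "\<And>x y. norm y \<le> R \<Longrightarrow> exp (- (norm (x - y))\<^sup>2 / tail_scale\<^sup>2) \<le> C * q x"
    using tail_dominated[OF assms(3)] by blast
  have "gauss_density \<sigma> (x - y) \<le> (1 / \<sigma>) ^ CARD('d) * C * q x" if "norm y \<le> R" for x y
  proof -
    have "(1 / \<sigma>) ^ CARD('d) * exp (- (norm (x - y))\<^sup>2 / (4 * \<sigma>\<^sup>2)) \<le> (1 / \<sigma>) ^ CARD('d)"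
      using assms(1) by (intro mult_left_le) auto
    then have "gauss_density \<sigma> (x - y) \<le> (1 / \<sigma>) ^ CARD('d) * exp (- (norm (x - y))\<^sup>2 / tail_scale\<^sup>2)"
      by (intro order_trans[OF gauss_density_split[OF assms(1,2)]] mult_right_mono) auto
    also have "\<dots> \<le> (1 / \<sigma>) ^ CARD('d) * (C * q x)"
      using C(2)[OF that] assms(1) by (intro mult_left_mono) auto
    finally show ?thesis by (simp add: mult.assoc)
  qed
  then show ?thesis using C(1) assms(1) by (intro exI[of _ "(1 / \<sigma>) ^ CARD('d) * C"]) auto
qed

text \<open>
  Away from its centre a Gaussian stays bounded as the bandwidth shrinks: with \<open>u = 1 / (4 \<sigma>\<^sup>2)\<close> the
  peak \<open>\<sigma>\<^sup>-\<^sup>d\<close> is at most \<open>1 + (4 u)\<^sup>d\<close>, which is at most a constant times \<open>exp u\<close>.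
\<close>

lemma gauss_density_dominated_uniform:
  assumes "0 \<le> R"
  shows "\<exists>C\<ge>0. \<forall>\<sigma> x y. 0 < \<sigma> \<longrightarrow> \<sigma> \<le> tail_scale / 2 \<longrightarrow> norm y \<le> R \<longrightarrow> 1 \<le> norm (x - y)
    \<longrightarrow> gauss_density \<sigma> (x - y) \<le> C * q x"
proof -
  obtain C where C: "0 \<le> C" "\<And>x y. norm y \<le> R \<Longrightarrow> exp (- (norm (x - y))\<^sup>2 / tail_scale\<^sup>2) \<le> C * q x"
    using tail_dominated[OF assms] by blast
  define K where "K = 1 + 4 ^ CARD('d) * (fact (CARD('d)) :: real)"
  have "0 \<le> K" by (simp add: K_def)
  have "gauss_density \<sigma> (x - y) \<le> K * C * q x"
    if \<sigma>: "0 < \<sigma>" "\<sigma> \<le> tail_scale / 2" and y: "norm y \<le> R" and far: "1 \<le> norm (x - y)" for \<sigma> x y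
  proof -
    define u where "u = 1 / (4 * \<sigma>\<^sup>2)"
    have u: "0 \<le> u" by (simp add: u_def)
    have "(1 / \<sigma>) ^ CARD('d) \<le> 1 + ((1 / \<sigma>) ^ CARD('d))\<^sup>2"
    proof -
      have "0 \<le> (2 * (1 / \<sigma>) ^ CARD('d) - 1)\<^sup>2" by simp
      then show ?thesis by (simp add: power2_eq_square algebra_simps)
    qed
    also have "((1 / \<sigma>) ^ CARD('d))\<^sup>2 = 4 ^ CARD('d) * u ^ CARD('d)"
      unfolding u_def power_mult_distrib[symmetric]
      by (simp add: power_even_eq[symmetric] power_mult power_one_over mult.commute flip: power_mult)
    also have "\<dots> \<le> 4 ^ CARD('d) * (fact (CARD('d)) * exp u)"
      by (intro mult_left_mono power_le_fact_exp u) auto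
    also have "1 + 4 ^ CARD('d) * (fact (CARD('d)) * exp u) \<le> K * exp u"
      unfolding K_def using u by (simp add: algebra_simps)
    finally have pk: "(1 / \<sigma>) ^ CARD('d) \<le> K * exp u" by simp
    have "exp (- (norm (x - y))\<^sup>2 / (4 * \<sigma>\<^sup>2)) \<le> exp (- u)"
      unfolding u_def using \<sigma> far by (simp add: divide_right_mono)
    with pk have "(1 / \<sigma>) ^ CARD('d) * exp (- (norm (x - y))\<^sup>2 / (4 * \<sigma>\<^sup>2)) \<le> (K * exp u) * exp (- u)"
      using \<open>0 \<le> K\<close> by (intro mult_mono) auto
    then have "(1 / \<sigma>) ^ CARD('d) * exp (- (norm (x - y))\<^sup>2 / (4 * \<sigma>\<^sup>2)) \<le> K"
      by (simp add: mult.assoc exp_minus_inverse)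
    then have "gauss_density \<sigma> (x - y) \<le> K * exp (- (norm (x - y))\<^sup>2 / tail_scale\<^sup>2)"
      by (intro order_trans[OF gauss_density_split[OF \<sigma>]] mult_right_mono) auto
    also have "\<dots> \<le> K * (C * q x)"
      using C(2)[OF y] \<open>0 \<le> K\<close> by (intro mult_left_mono) auto
    finally show ?thesis by (simp add: mult.assoc)
  qed
  then show ?thesis using \<open>0 \<le> K\<close> C(1) by (intro exI[of _ "K * C"]) auto
qed

lemma integral_gp_density:
  assumes "g \<in> (Q_GP :: (real^'d \<Rightarrow> real) set)"
  shows "(\<integral>x. g x \<partial>lborel) = 1"
  using Q_GP_facts[OF assms] by (subst integral_eq_nn_integral) (auto intro: less_imp_le)

lemma kl_gap_gp_density:
  assumes "g \<in> Q_GP" "\<And>x. g x \<le> C * q x"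
  shows "0 \<le> kl_gap m g"
  using m_min[OF assms] by (simp add: kl_gap_def integral_gp_density[OF assms(1)])

text \<open>
  Continuous paths that converge almost everywhere to \<open>\<psi>\<close> are projected to the ball that contains
  the values of \<open>\<psi>\<close>, so that one dominating constant serves all of them.
\<close>

lemma kl_gap_mix_uniform:
  assumes [measurable]: "\<psi> \<in> borel_measurable unit_unif"
    and bd: "\<And>\<eta>. norm (\<psi> \<eta>) \<le> R" and \<sigma>: "0 < \<sigma>" "\<sigma> \<le> tail_scale / 2"
  shows "0 \<le> kl_gap m (gauss_mix unit_unif \<psi> \<sigma>)"
proof -
  interpret U: prob_space unit_unif by (rule prob_space_unit_unif)
  have "0 \<le> R" using bd[of 0] norm_ge_zero order_trans by blast
  have "(\<lambda>\<eta>. indicator {0..1} \<eta> *\<^sub>R \<psi> \<eta>) \<in> borel_measurable borel"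
    using assms(1) by (simp add: borel_measurable_restrict_space_iff)
  then obtain g where g: "\<And>k. continuous_on UNIV (g k)"
    and lim: "AE \<eta> in lborel. (\<lambda>k. g k \<eta>) \<longlonglongrightarrow> indicator {0..1} \<eta> *\<^sub>R \<psi> \<eta>"
    using continuous_approx_AE by blast
  define \<mu> where "\<mu> k \<eta> = closest_point (cball 0 R) (g k \<eta>)" for k \<eta>
  have proj: "continuous_on UNIV (closest_point (cball 0 R :: (real^'d) set))"
    using \<open>0 \<le> R\<close> by (intro continuous_on_closest_point) auto
  have \<mu>: "continuous_on {0..1} (\<mu> k)" for k
    unfolding \<mu>_def
    by (rule continuous_on_compose2[OF proj continuous_on_subset[OF g]]) auto
  have [measurable]: "\<mu> k \<in> borel_measurable unit_unif" for k
    using borel_measurable_continuous_on_restrict[OF \<mu>]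
    by (simp add: measurable_cong_sets[OF sets_restrict_space_cong[OF sets_lborel]])
  have "norm (\<mu> k \<eta>) \<le> R" for k \<eta>
    using closest_point_in_set[of "cball 0 R" "g k \<eta>"] \<open>0 \<le> R\<close> by (auto simp: \<mu>_def)
  moreover obtain C where "0 \<le> C"
    and C: "\<And>x y. norm y \<le> R \<Longrightarrow> gauss_density \<sigma> (x - y) \<le> C * q x"
    using gauss_density_dominated[OF \<sigma> \<open>0 \<le> R\<close>] by blast
  ultimately have dom: "gauss_mix unit_unif (\<mu> k) \<sigma> x \<le> C * q x" for k x
    using U.gauss_mix_le[of "\<mu> k" \<sigma> x "C * q x"] U.prob_space by simp
  have lim': "AE \<eta> in unit_unif. (\<lambda>k. \<mu> k \<eta>) \<longlonglongrightarrow> \<psi> \<eta>"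
  proof -
    have "AE \<eta> in lborel. \<eta> \<in> {0..1} \<longrightarrow> (\<lambda>k. \<mu> k \<eta>) \<longlonglongrightarrow> \<psi> \<eta>"
      using lim
    proof eventually_elim
      case (elim \<eta>)
      show ?case
      proof
        assume "\<eta> \<in> {0..1}"
        then have "(\<lambda>k. g k \<eta>) \<longlonglongrightarrow> \<psi> \<eta>" using elim by simp
        then have "(\<lambda>k. \<mu> k \<eta>) \<longlonglongrightarrow> closest_point (cball 0 R) (\<psi> \<eta>)"
          unfolding \<mu>_def
          by (rule isCont_tendsto_compose[rotated]) (use proj in \<open>simp add: continuous_on_eq_continuous_at\<close>)
        also have "closest_point (cball 0 R) (\<psi> \<eta>) = \<psi> \<eta>"
          using bd[of \<eta>] by (intro closest_point_self) auto
        finally show "(\<lambda>k. \<mu> k \<eta>) \<longlonglongrightarrow> \<psi> \<eta>" .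
      qed
    qed
    then show ?thesis by (subst AE_restrict_space_iff) auto
  qed
  show ?thesis
  proof (rule kl_gap_nonneg_limit)
    show "gauss_mix unit_unif (\<mu> k) \<sigma> \<in> borel_measurable borel" for k
      by (rule U.measurable_gauss_mix) simp
    show "gauss_mix unit_unif \<psi> \<sigma> \<in> borel_measurable borel"
      by (rule U.measurable_gauss_mix) simp
    show "0 \<le> gauss_mix unit_unif (\<mu> k) \<sigma> x" for k x by (rule gauss_mix_nonneg)
    show "gauss_mix unit_unif (\<mu> k) \<sigma> x \<le> C * q x" for k x by (rule dom)
    show "AE x in lborel. (\<lambda>k. gauss_mix unit_unif (\<mu> k) \<sigma> x) \<longlonglongrightarrow> gauss_mix unit_unif \<psi> \<sigma> x"
      by (intro AE_I2 U.gauss_mix_tendsto lim') simp_all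
    show "0 \<le> kl_gap m (gauss_mix unit_unif (\<mu> k) \<sigma>)" for k
    proof (rule kl_gap_gp_density)
      show "gauss_mix unit_unif (\<mu> k) \<sigma> \<in> Q_GP"
        using \<mu> \<sigma>(1) by (auto simp: Q_GP_def gp_density_eq_gauss_mix)
    qed (rule dom)
  qed
qed

text \<open>
  The identity map is the limit of simple maps, and a simple map has a finite law, which is also the
  law of a measurable map on \<open>[0,1]\<close>.
\<close>

lemma kl_gap_mix_compact:
  assumes "finite_measure M" and sets: "sets M = sets borel"
    and supp: "AE y in M. norm y \<le> R" and "0 \<le> R" and \<sigma>: "0 < \<sigma>" "\<sigma> \<le> tail_scale / 2"
  shows "0 \<le> kl_gap m (gauss_mix M (\<lambda>y. y) \<sigma>)"
proof -
  interpret finite_measure M by fact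
  interpret U: prob_space unit_unif by (rule prob_space_unit_unif)
  have borel_M[simp]: "borel_measurable M = (borel_measurable borel :: (real^'d \<Rightarrow> real^'d) set)"
    by (rule measurable_cong_sets[OF sets refl])
  have [simp]: "space M = UNIV" using sets_eq_imp_space_eq[OF sets] by simp
  let ?f = "\<lambda>y :: real^'d. indicator (cball 0 R) y *\<^sub>R y"
  have "?f \<in> borel_measurable borel"
    by (intro borel_measurable_scaleR borel_measurable_indicator) auto
  then have f: "?f \<in> borel_measurable M" by simp
  obtain s where s: "\<And>k. simple_function M (s k)" and lim: "\<And>y. (\<lambda>k. s k y) \<longlonglongrightarrow> ?f y"
    and bd: "\<And>k y. dist (s k y) 0 \<le> 2 * dist (?f y) 0"
    using borel_measurable_implies_sequence_metric[OF f, of 0] by auto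
  have s_meas: "s k \<in> borel_measurable M" for k using s by (rule borel_measurable_simple_function)
  have s_bd: "norm (s k y) \<le> 2 * R" for k y
    using bd[of k y] \<open>0 \<le> R\<close> by (cases "norm y \<le> R") auto
  obtain C where "0 \<le> C" and C: "\<And>x y. norm y \<le> 2 * R \<Longrightarrow> gauss_density \<sigma> (x - y) \<le> C * q x"
    using gauss_density_dominated[OF \<sigma>, of "2 * R"] \<open>0 \<le> R\<close>
    by (meson mult_nonneg_nonneg zero_le_numeral)
  show ?thesis
  proof (rule kl_gap_nonneg_limit)
    show "gauss_mix M (s k) \<sigma> \<in> borel_measurable borel" for k
      by (rule measurable_gauss_mix[OF s_meas])
    show "gauss_mix M (\<lambda>y. y) \<sigma> \<in> borel_measurable borel"
      by (rule measurable_gauss_mix) simp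
    show "0 \<le> gauss_mix M (s k) \<sigma> x" for k x by (rule gauss_mix_nonneg)
    show "gauss_mix M (s k) \<sigma> x \<le> (C * measure M (space M)) * q x" for k x
      using gauss_mix_le[OF s_meas, where c = "C * q x" and \<sigma> = \<sigma> and x = x] C[OF s_bd] by (simp add: mult_ac)
    have id_lim: "AE y in M. (\<lambda>k. s k y) \<longlonglongrightarrow> y"
      using supp
    proof eventually_elim
      case (elim y)
      then show ?case using lim[of y] by simp
    qed
    show "AE x in lborel. (\<lambda>k. gauss_mix M (s k) \<sigma> x) \<longlonglongrightarrow> gauss_mix M (\<lambda>y. y) \<sigma> x"
      by (rule AE_I2, rule gauss_mix_tendsto[OF s_meas _ id_lim]) simp
    show "0 \<le> kl_gap m (gauss_mix M (s k) \<sigma>)" for k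
    proof -
      obtain \<psi> where \<psi>: "\<psi> \<in> borel_measurable unit_unif" "\<And>\<eta>. norm (\<psi> \<eta>) \<le> 2 * R"
        and eq: "\<And>\<sigma> x. gauss_mix M (s k) \<sigma> x = measure M (space M) * gauss_mix unit_unif \<psi> \<sigma> x"
        using simple_law_as_map_of_uniform[OF \<open>finite_measure M\<close> s[of k], of "2 * R"] s_bd \<open>0 \<le> R\<close>
        by auto
      have dom: "gauss_mix unit_unif \<psi> \<sigma> x \<le> C * q x" for x
        using U.gauss_mix_le[OF \<psi>(1), of \<sigma> x "C * q x"] C[OF \<psi>(2)] U.prob_space by simp
      have "(\<integral>x. gauss_mix unit_unif \<psi> \<sigma> x \<partial>lborel) = 1"
        using U.nn_integral_gauss_mix[OF \<psi>(1) \<sigma>(1)] U.emeasure_space_1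
        by (subst integral_eq_nn_integral)
          (auto simp: gauss_mix_nonneg intro!: U.measurable_gauss_mix \<psi>)
      then have "kl_gap m (gauss_mix M (s k) \<sigma>) = measure M (space M) * kl_gap m (gauss_mix unit_unif \<psi> \<sigma>)"
        unfolding eq[abs_def]
        by (intro kl_gap_scale[OF _ gauss_mix_nonneg dom U.measurable_gauss_mix[OF \<psi>(1)]]) auto
      then show ?thesis
        using kl_gap_mix_uniform[OF \<psi> \<sigma>] by (simp add: measure_nonneg)
    qed
  qed
qed

text \<open>
  Convolution with a vanishing bandwidth. Domination by \<open>q\<close> uniformly in the bandwidth has two
  sources: on a bounded set the convolution is at most the maximum of \<open>g\<close>, and at distance at least 1
  from the support the Gaussians themselves are uniformly dominated.
\<close>

lemma kl_gap_continuous_compact: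
  assumes g: "continuous_on UNIV g" and nn: "\<And>x. 0 \<le> g x" and bd: "\<And>x. g x \<le> B"
    and supp: "\<And>x. R < norm x \<Longrightarrow> g x = 0" and "0 \<le> R"
  shows "0 \<le> kl_gap m g"
proof -
  have [measurable]: "g \<in> borel_measurable borel" using g by (rule borel_measurable_continuous_onI)
  let ?M = "density lborel (\<lambda>x. ennreal (g x))"
  have "0 \<le> B" using nn bd order_trans by blast
  have "emeasure ?M (space ?M) = (\<integral>\<^sup>+x. ennreal (g x) \<partial>lborel)"
    by (simp add: emeasure_density)
  also have "\<dots> \<le> (\<integral>\<^sup>+x. ennreal B * indicator (cball 0 R) (x :: real^'d) \<partial>lborel)"
  proof (rule nn_integral_mono)
    fix x :: "real^'d"
    show "ennreal (g x) \<le> ennreal B * indicator (cball 0 R) x"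
      using bd[of x] supp[of x] by (cases "norm x \<le> R") (auto intro: ennreal_leI)
  qed
  also have "\<dots> < \<infinity>"
    using emeasure_lborel_cball_finite[of "0 :: real^'d" R]
    by (simp add: nn_integral_cmult_indicator ennreal_mult_less_top)
  finally have fin: "finite_measure ?M" by (intro finite_measureI) auto
  interpret finite_measure ?M by (rule fin)
  define \<sigma> where "\<sigma> k = tail_scale / 2 / real (Suc k)" for k
  have \<sigma>: "0 < \<sigma> k" "\<sigma> k \<le> tail_scale / 2" for k
    using tail_scale_pos by (auto simp: \<sigma>_def field_simps)
  have \<sigma>0: "\<sigma> \<longlonglongrightarrow> 0"
    unfolding \<sigma>_def[abs_def] divide_inverse[of "tail_scale / 2"]
    by (rule tendsto_mult_right_zero[OF LIMSEQ_inverse_real_of_nat])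
  have conv: "gauss_mix ?M (\<lambda>y. y) (\<sigma> k) x = (\<integral>z. g (x + \<sigma> k *\<^sub>R z) * gauss_density 1 z \<partial>lborel)" for k x
    by (rule gauss_mix_convolution) (use nn \<sigma> in auto)
  have gauss1: "integrable lborel (gauss_density 1 :: real^'d \<Rightarrow> real)"
    "(\<integral>z. gauss_density 1 (z :: real^'d) \<partial>lborel) = 1"
  proof -
    have "(\<integral>\<^sup>+z. gauss_density 1 (z :: real^'d) \<partial>lborel) = 1"
      using nn_integral_gauss_density[of 1 "0 :: real^'d"] by simp
    then show "integrable lborel (gauss_density 1 :: real^'d \<Rightarrow> real)"
      "(\<integral>z. gauss_density 1 (z :: real^'d) \<partial>lborel) = 1"
      by (auto intro!: integrableI_nonneg simp: gauss_density_nonneg integral_eq_nn_integral)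
  qed
  have bnd: "norm (g (x + \<sigma> k *\<^sub>R z) * gauss_density 1 z) \<le> B * gauss_density 1 z" for x z k
    using nn bd by (simp add: abs_mult gauss_density_nonneg mult_right_mono)
  have le_B: "gauss_mix ?M (\<lambda>y. y) (\<sigma> k) x \<le> B" for k x
  proof -
    have "gauss_mix ?M (\<lambda>y. y) (\<sigma> k) x \<le> (\<integral>z. B * gauss_density 1 (z :: real^'d) \<partial>lborel)"
      unfolding conv
    proof (rule integral_mono')
      show "integrable lborel (\<lambda>z :: real^'d. B * gauss_density 1 z)" using gauss1 by simp
      show "g (x + \<sigma> k *\<^sub>R z) * gauss_density 1 z \<le> B * gauss_density 1 z" for z
        using bnd[of x k z] by simp
    qed (use \<open>0 \<le> B\<close> in \<open>auto simp: gauss_density_nonneg\<close>)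
    then show ?thesis by (simp add: gauss1)
  qed
  have lim: "(\<lambda>k. gauss_mix ?M (\<lambda>y. y) (\<sigma> k) x) \<longlonglongrightarrow> g x" for x
  proof -
    have "(\<lambda>k. \<integral>z. g (x + \<sigma> k *\<^sub>R z) * gauss_density 1 z \<partial>lborel)
        \<longlonglongrightarrow> (\<integral>z. g x * gauss_density 1 (z :: real^'d) \<partial>lborel)"
    proof (rule integral_dominated_convergence[where w = "\<lambda>z. B * gauss_density 1 z"])
      show "AE z in lborel. (\<lambda>k. g (x + \<sigma> k *\<^sub>R z) * gauss_density 1 z) \<longlonglongrightarrow> g x * gauss_density 1 z"
      proof (rule AE_I2)
        fix z :: "real^'d"
        have "(\<lambda>k. x + \<sigma> k *\<^sub>R z) \<longlonglongrightarrow> x + 0 *\<^sub>R z"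
          by (intro tendsto_intros \<sigma>0)
        then have "(\<lambda>k. g (x + \<sigma> k *\<^sub>R z)) \<longlonglongrightarrow> g x"
          using g by (auto simp: continuous_on_eq_continuous_at intro: isCont_tendsto_compose)
        then show "(\<lambda>k. g (x + \<sigma> k *\<^sub>R z) * gauss_density 1 z) \<longlonglongrightarrow> g x * gauss_density 1 z"
          by (rule tendsto_mult_right)
      qed
    qed (use bnd gauss1 in auto)
    then show ?thesis by (simp add: conv gauss1)
  qed
  obtain C1 where "0 \<le> C1"
    and C1: "\<And>x y. norm y \<le> R + 1 \<Longrightarrow> exp (- (norm (x - y))\<^sup>2 / tail_scale\<^sup>2) \<le> C1 * q x"
    using tail_dominated[of "R + 1"] \<open>0 \<le> R\<close> by auto
  obtain C2 where "0 \<le> C2"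
    and C2: "\<And>k x y. norm y \<le> R \<Longrightarrow> 1 \<le> norm (x - y) \<Longrightarrow> gauss_density (\<sigma> k) (x - y) \<le> C2 * q x"
    using gauss_density_dominated_uniform[OF \<open>0 \<le> R\<close>] \<sigma> by blast
  let ?C = "B * C1 + C2 * measure ?M (space ?M)"
  have dom: "gauss_mix ?M (\<lambda>y. y) (\<sigma> k) x \<le> ?C * q x" for k x
  proof (cases "norm x \<le> R + 1")
    case True
    then have "B * 1 \<le> B * (C1 * q x)"
      using C1[of x x] \<open>0 \<le> B\<close> by (intro mult_left_mono) auto
    moreover have "0 \<le> C2 * measure ?M (space ?M) * q x"
      using \<open>0 \<le> C2\<close> q_pos[of x] by (intro mult_nonneg_nonneg) (auto intro: less_imp_le)
    ultimately show ?thesis using le_B[of k x] by (simp add: algebra_simps)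
  next
    case False
    have "AE y in ?M. gauss_density (\<sigma> k) (x - y) \<le> C2 * q x"
    proof (subst AE_density)
      show "AE y in lborel. 0 < ennreal (g y) \<longrightarrow> gauss_density (\<sigma> k) (x - y) \<le> C2 * q x"
      proof (intro AE_I2 impI)
        fix y assume "0 < ennreal (g y)"
        then have y: "norm y \<le> R" using supp[of y] by (force simp: not_le[symmetric])
        have "1 \<le> norm (x - y)" using norm_triangle_ineq2[of x y] y False by linarith
        then show "gauss_density (\<sigma> k) (x - y) \<le> C2 * q x" by (rule C2[OF y])
      qed
    qed simp
    then have "gauss_mix ?M (\<lambda>y. y) (\<sigma> k) x \<le> C2 * q x * measure ?M (space ?M)"
      by (intro gauss_mix_le) auto
    moreover have "0 \<le> B * C1 * q x"
      using \<open>0 \<le> B\<close> \<open>0 \<le> C1\<close> q_pos[of x] by (intro mult_nonneg_nonneg) (auto intro: less_imp_le)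
    ultimately show ?thesis by (simp add: algebra_simps)
  qed
  show ?thesis
  proof (rule kl_gap_nonneg_limit)
    show "gauss_mix ?M (\<lambda>y. y) (\<sigma> k) \<in> borel_measurable borel" for k
      by (rule measurable_gauss_mix) simp
    show "0 \<le> gauss_mix ?M (\<lambda>y. y) (\<sigma> k) x" for k x by (rule gauss_mix_nonneg)
    show "gauss_mix ?M (\<lambda>y. y) (\<sigma> k) x \<le> ?C * q x" for k x by (rule dom)
    show "AE x in lborel. (\<lambda>k. gauss_mix ?M (\<lambda>y. y) (\<sigma> k) x) \<longlonglongrightarrow> g x"
      by (intro AE_I2 lim)
    have "AE y in ?M. norm y \<le> R"
    proof (subst AE_density)
      show "AE y in lborel. 0 < ennreal (g y) \<longrightarrow> norm y \<le> R"
        using supp by (intro AE_I2 impI) (force simp: not_le[symmetric])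
    qed simp
    then show "0 \<le> kl_gap m (gauss_mix ?M (\<lambda>y. y) (\<sigma> k))" for k
      by (intro kl_gap_mix_compact[OF fin _ _ \<open>0 \<le> R\<close> \<sigma>]) auto
  qed simp
qed

lemma kl_gap_bounded_compact:
  assumes h[measurable]: "h \<in> borel_measurable borel" and nn: "\<And>x. 0 \<le> h x"
    and bd: "\<And>x. h x \<le> B" and supp: "\<And>x. R < norm x \<Longrightarrow> h x = 0" and "0 \<le> R"
  shows "0 \<le> kl_gap m h"
proof -
  have "0 \<le> B" using nn bd order_trans by blast
  obtain g where g: "\<And>k. continuous_on UNIV (g k)"
    and lim: "AE x in lborel. (\<lambda>k. g k x) \<longlonglongrightarrow> h x"
    using continuous_approx_AE[OF h] by blast
  \<comment> \<open>clipping to \<open>[0, B]\<close> and a continuous cutoff keep the limit \<open>h\<close>, which is 0 where the cutoff is not 1\<close>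
  define c where "c k x = max 0 (min B (g k x)) * max 0 (min 1 (R + 1 - norm x))" for k x
  have cont: "continuous_on UNIV (c k)" for k
    unfolding c_def by (intro continuous_intros g)
  have c_nn: "0 \<le> c k x" for k x by (simp add: c_def)
  have c_le: "c k x \<le> B" for k x
    unfolding c_def using \<open>0 \<le> B\<close> by (intro order_trans[OF mult_left_le]) auto
  have c_supp: "c k x = 0" if "R + 1 < norm x" for k x
    using that by (simp add: c_def max_def)
  obtain C where "0 \<le> C"
    and C: "\<And>x y. norm y \<le> R + 1 \<Longrightarrow> exp (- (norm (x - y))\<^sup>2 / tail_scale\<^sup>2) \<le> C * q x"
    using tail_dominated[of "R + 1"] \<open>0 \<le> R\<close> by auto
  show ?thesis
  proof (rule kl_gap_nonneg_limit)
    show "c k \<in> borel_measurable borel" for k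
      using cont by (rule borel_measurable_continuous_onI)
    show "c k x \<le> (B * C) * q x" for k x
    proof (cases "norm x \<le> R + 1")
      case True
      then have "B * 1 \<le> B * (C * q x)"
        using C[of x x] \<open>0 \<le> B\<close> by (intro mult_left_mono) auto
      then show ?thesis using c_le[of k x] by simp
    next
      case False
      then show ?thesis
        using c_supp[of x k] \<open>0 \<le> B\<close> \<open>0 \<le> C\<close> q_pos[of x] by (simp add: less_imp_le)
    qed
    show "AE x in lborel. (\<lambda>k. c k x) \<longlonglongrightarrow> h x"
      using lim
    proof eventually_elim
      case (elim x)
      have "(\<lambda>k. c k x) \<longlonglongrightarrow> max 0 (min B (h x)) * max 0 (min 1 (R + 1 - norm x))"
        unfolding c_def by (intro tendsto_intros elim)
      also have "max 0 (min B (h x)) * max 0 (min 1 (R + 1 - norm x)) = h x"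
        using nn[of x] bd[of x] supp[of x] by (cases "norm x \<le> R") auto
      finally show ?case .
    qed
    show "0 \<le> kl_gap m (c k)" for k
      by (rule kl_gap_continuous_compact[where R = "R + 1", OF cont c_nn c_le c_supp]) (use \<open>0 \<le> R\<close> in auto)
  qed (use c_nn in auto)
qed

text \<open>
  The restriction of \<open>p\<close> to \<open>{\<bar>x\<bar> \<le> k, p \<le> k}\<close> has logarithmic ratio 0 to \<open>p\<close>, so its gap only
  involves its mass, which tends to 1.
\<close>

theorem min_value_nonpos:
  assumes p_nn: "\<And>x. 0 \<le> p x" and p_mass: "(\<integral>x. p x \<partial>lborel) = 1"
  shows "m \<le> 0"
proof -
  have p_int: "integrable lborel p" using p_mass not_integrable_integral_eq by fastforce
  define h where "h k x = (if norm x \<le> real k \<and> p x \<le> real k then p x else 0)" for k x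
  have [measurable]: "h k \<in> borel_measurable borel" for k unfolding h_def by measurable
  let ?P = "\<lambda>k. \<integral>x. h k x \<partial>lborel"
  have P_lim: "?P \<longlonglongrightarrow> 1"
    unfolding p_mass[symmetric]
  proof (rule integral_dominated_convergence[where w = p])
    show "AE x in lborel. (\<lambda>k. h k x) \<longlonglongrightarrow> p x"
    proof (intro AE_I2 tendsto_eventually)
      fix x
      obtain K where "max (norm x) (p x) \<le> real K" using real_arch_simple by blast
      then have "\<forall>k\<ge>K. h k x = p x" by (auto simp: h_def)
      then show "\<forall>\<^sub>F k in sequentially. h k x = p x" by (auto simp: eventually_sequentially)
    qed
    show "AE x in lborel. norm (h k x) \<le> p x" for k using p_nn by (auto simp: h_def)
  qed (use p_int in auto)
  have gap: "kl_gap m (h k) = - (?P k * ln (?P k)) - m * ?P k" for k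
  proof -
    have "(\<lambda>x. h k x * ln (h k x / p x)) = (\<lambda>x. 0)" by (auto simp: h_def)
    then show ?thesis by (simp only: kl_gap_def) simp
  qed
  have P_nn: "0 \<le> ?P k" for k using p_nn by (auto simp: h_def intro!: Bochner_Integration.integral_nonneg)
  have "(\<lambda>k. kl_gap m (h k)) \<longlonglongrightarrow> - (1 * ln 1) - m * 1"
    unfolding gap by (intro tendsto_intros tendsto_x_ln_x P_nn P_lim)
  moreover have "0 \<le> kl_gap m (h k)" for k
    by (rule kl_gap_bounded_compact[where B = "real k" and R = "real k"]) (use p_nn in \<open>auto simp: h_def\<close>)
  ultimately have "0 \<le> - (1 * ln 1) - m * 1"
    by (intro LIMSEQ_le_const[of "\<lambda>k. kl_gap m (h k)"]) auto
  then show ?thesis by simp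
qed

text \<open>
  The equality case of Gibbs' inequality: \<open>q ln (q / p) - q + p\<close> is nonnegative, has integral at most 0,
  and vanishes only where \<open>q = p\<close>.
\<close>

theorem minimizer_eq_target:
  assumes p_nn: "\<And>x. 0 \<le> p x" and p_mass: "(\<integral>x. p x \<partial>lborel) = 1"
    and m: "m = (\<integral>x. q x * ln (q x / p x) \<partial>lborel)"
  shows "AE x in lborel. q x = p x"
proof -
  have p_int: "integrable lborel p" using p_mass not_integrable_integral_eq by fastforce
  let ?d = "\<lambda>x. q x * ln (q x / p x) - q x + p x"
  have pt: "0 \<le> ?d x \<and> (?d x = 0 \<longrightarrow> q x = p x)" if "0 < p x" for x
  proof -
    let ?t = "p x / q x"
    have t: "0 < ?t" using that q_pos[of x] by simp
    have eq: "?d x = q x * (?t - 1 - ln ?t)"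
      using that q_pos[of x] by (simp add: ln_div algebra_simps)
    have "?t = 1" if "?d x = 0"
    proof -
      have "ln ?t = ?t - 1" using that eq q_pos[of x] by simp
      then show ?thesis by (rule ln_eq_minus_one[OF t])
    qed
    moreover have "0 \<le> ?d x"
      unfolding eq using ln_le_minus_one[OF t] q_pos[of x] by (intro mult_nonneg_nonneg) auto
    ultimately show ?thesis using q_pos[of x] by auto
  qed
  have int: "integrable lborel ?d" using kl_int q_int p_int by auto
  have ae: "AE x in lborel. 0 \<le> ?d x" using p_pos by eventually_elim (use pt in auto)
  have "(\<integral>x. ?d x \<partial>lborel) = m"
    using kl_int q_int p_int by (simp add: m p_mass integral_gp_density[OF q_gp])
  moreover have "0 \<le> (\<integral>x. ?d x \<partial>lborel)" by (rule integral_nonneg_AE[OF ae])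
  ultimately have "(\<integral>x. ?d x \<partial>lborel) = 0" using min_value_nonpos[OF p_nn p_mass] by simp
  then have "AE x in lborel. ?d x = 0"
    using integral_nonneg_eq_0_iff_AE[OF int ae] by simp
  then show ?thesis using p_pos by eventually_elim (use pt in auto)
qed

end

lemma eintegral_ereal_AE:
  assumes h: "integrable M h" and eq: "AE x in M. g x = ereal (h x)"
  shows "eintegral M g = ereal (\<integral>x. h x \<partial>M)"
proof -
  have "(\<integral>\<^sup>+ x. e2ennreal (g x) \<partial>M) = (\<integral>\<^sup>+ x. ennreal (h x) \<partial>M)"
    using eq by (intro nn_integral_cong_AE) (auto elim!: eventually_mono)
  moreover have "(\<integral>\<^sup>+ x. e2ennreal (- g x) \<partial>M) = (\<integral>\<^sup>+ x. ennreal (- h x) \<partial>M)"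
    using eq by (intro nn_integral_cong_AE) (auto elim!: eventually_mono)
  moreover have "(\<integral>\<^sup>+ x. ennreal (h x) \<partial>M) \<noteq> \<infinity>" "(\<integral>\<^sup>+ x. ennreal (- h x) \<partial>M) \<noteq> \<infinity>"
    using h by (auto simp: real_integrable_def)
  then obtain a b where "0 \<le> a" "(\<integral>\<^sup>+ x. ennreal (h x) \<partial>M) = ennreal a"
    "0 \<le> b" "(\<integral>\<^sup>+ x. ennreal (- h x) \<partial>M) = ennreal b"
    by (metis ennreal_cases infinity_ennreal_def)
  ultimately show ?thesis
    unfolding eintegral_def real_lebesgue_integral_def[OF h] by (simp add: enn2ereal_ennreal)
qed

lemma ereal_mult_elog_ratio:
  assumes "0 \<le> a" "0 < b"
  shows "ereal a * elog (ennreal a / ennreal b) = ereal (a * ln (a / b))"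
proof (cases "a = 0")
  case False
  then have "0 < a" using assms by simp
  then have "ennreal a / ennreal b = ennreal (a / b)" using assms by (simp add: divide_ennreal)
  then show ?thesis using \<open>0 < a\<close> assms by (simp add: elog_def ennreal_eq_0_iff not_le)
qed (simp flip: zero_ereal_def)

text \<open>
  A point with \<open>p x = 0 < q x\<close> contributes \<open>\<infinity>\<close>, so a finite divergence forces \<open>p > 0\<close> almost
  everywhere. The convention \<open>\<infinity> - \<infinity> = \<infinity>\<close> makes both the positive and the negative part finite.
\<close>

lemma kl_div_finiteD:
  assumes [measurable]: "q \<in> borel_measurable borel" "p \<in> borel_measurable borel"
    and q: "\<And>x::'a::euclidean_space. 0 < q x" and p: "\<And>x. 0 \<le> p x"
    and fin: "\<bar>kl_div lborel q p\<bar> \<noteq> \<infinity>"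
  shows "AE x in lborel. 0 < p x" "integrable lborel (\<lambda>x. q x * ln (q x / p x))"
proof -
  let ?g = "\<lambda>x. ereal (q x) * elog (ennreal (q x) / ennreal (p x))"
  let ?h = "\<lambda>x. q x * ln (q x / p x)"
  let ?A = "\<integral>\<^sup>+ x. e2ennreal (?g x) \<partial>lborel" and ?B = "\<integral>\<^sup>+ x. e2ennreal (- ?g x) \<partial>lborel"
  have "?A \<noteq> \<infinity>" and "?B \<noteq> \<infinity>"
    using fin unfolding kl_div_def eintegral_def
    by (cases ?A; cases ?B; simp add: top_ennreal.rep_eq)+
  have g_pos: "?g x = ereal (?h x)" if "0 < p x" for x
    using ereal_mult_elog_ratio[OF less_imp_le[OF q] that] .
  have g0: "?g x = \<infinity>" if "p x = 0" for x
  proof -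
    have "ennreal (q x) / ennreal 0 = \<infinity>"
      using q[of x] by (simp add: ennreal_divide_zero ennreal_eq_0_iff not_le)
    then show ?thesis using q[of x] that by (simp add: elog_def)
  qed
  have p_cases: "p x = 0 \<or> 0 < p x" for x using p[of x] by auto
  have eqA: "e2ennreal (?g x) = (if p x = 0 then \<infinity> else ennreal (?h x))" for x
    using p_cases[of x] g0[of x] g_pos[of x] by auto
  have "AE x in lborel. (if p x = 0 then \<infinity> else ennreal (?h x)) \<noteq> \<infinity>"
    using \<open>?A \<noteq> \<infinity>\<close> unfolding eqA by (intro nn_integral_PInf_AE) auto
  then show pos: "AE x in lborel. 0 < p x"
    by eventually_elim (use p_cases in \<open>auto split: if_splits\<close>)
  have "?A = (\<integral>\<^sup>+ x. ennreal (?h x) \<partial>lborel)" "?B = (\<integral>\<^sup>+ x. ennreal (- ?h x) \<partial>lborel)"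
    using pos g_pos by (auto intro!: nn_integral_cong_AE elim!: eventually_mono)
  then show "integrable lborel ?h"
    using \<open>?A \<noteq> \<infinity>\<close> \<open>?B \<noteq> \<infinity>\<close> by (simp add: real_integrable_def)
qed

theorem Q_GP_minimizer_eq_target:
  fixes p :: "real^'d \<Rightarrow> real"
  assumes [measurable]: "p \<in> borel_measurable borel" and p: "\<And>x. 0 \<le> p x"
    and p_mass: "(\<integral>x. p x \<partial>lborel) = 1"
    and min: "is_finite_arg_min (\<lambda>q. kl_div lborel q p) Q_GP q"
  shows "AE x in lborel. q x = p x"
proof -
  have le: "kl_div lborel q p \<le> kl_div lborel g p" if "g \<in> Q_GP" for g
    using min that by (auto simp: is_finite_arg_min_def is_arg_min_linorder)
  have q: "q \<in> Q_GP" and fin: "\<bar>kl_div lborel q p\<bar> \<noteq> \<infinity>"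
    using min by (auto simp: is_finite_arg_min_def is_arg_min_def)
  note [measurable] = Q_GP_facts(1)[OF q]
  note pos = kl_div_finiteD[OF Q_GP_facts(1)[OF q] assms(1) Q_GP_facts(2)[OF q] p fin]
  have int_q: "integrable lborel q"
    using Q_GP_facts(2,3)[OF q] by (intro integrableI_nonneg) (auto intro: less_imp_le)
  interpret kl_reference q p
    by unfold_locales (use pos Q_GP_facts[OF q] int_q in auto)
  have kl_eq: "kl_div lborel g p = ereal (\<integral>x. g x * ln (g x / p x) \<partial>lborel)"
    if g: "g \<in> Q_GP" and dom: "\<And>x. g x \<le> C * q x" for g C
    unfolding kl_div_def
  proof (rule eintegral_ereal_AE)
    show "integrable lborel (\<lambda>x. g x * ln (g x / p x))"
      using integrable_dominated(2)[OF Q_GP_facts(1)[OF g] _ dom] Q_GP_facts(2)[OF g]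
      by (simp add: less_imp_le)
    show "AE x in lborel. ereal (g x) * elog (ennreal (g x) / ennreal (p x)) = ereal (g x * ln (g x / p x))"
      using pos(1) by eventually_elim (use Q_GP_facts(2)[OF g] in \<open>auto intro: ereal_mult_elog_ratio less_imp_le\<close>)
  qed
  interpret gp_minimizer q p "\<integral>x. q x * ln (q x / p x) \<partial>lborel"
  proof unfold_locales
    fix g and C :: real assume g: "g \<in> Q_GP" and dom: "\<And>x. g x \<le> C * q x"
    have "ereal (\<integral>x. q x * ln (q x / p x) \<partial>lborel) \<le> ereal (\<integral>x. g x * ln (g x / p x) \<partial>lborel)"
      using le[OF g] kl_eq[OF g dom] kl_eq[OF q, of 1] by simp
    then show "(\<integral>x. q x * ln (q x / p x) \<partial>lborel) \<le> (\<integral>x. g x * ln (g x / p x) \<partial>lborel)" by simp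
  qed (rule q)
  show ?thesis by (rule minimizer_eq_target[OF p p_mass refl])
qed

section \<open>Tempered likelihoods\<close>

lemma powr_mult_powr_le_mix:
  fixes a b \<alpha> :: real
  assumes "0 \<le> a" "0 \<le> b" "0 < \<alpha>" "\<alpha> < 1"
  shows "a powr \<alpha> * b powr (1 - \<alpha>) \<le> \<alpha> * a + (1 - \<alpha>) * b"
proof (cases "a = 0 \<or> b = 0")
  case False
  then show ?thesis using assms Youngs_inequality_0[of \<alpha> "1 - \<alpha>" a b] by auto
qed (use assms in auto)

text \<open>
  For arguments in \<open>[0,1]\<close> the negative logarithm is nonnegative, possibly \<open>\<infinity>\<close>, and can be integrated
  without any integrability condition.
\<close>

definition neg_log :: "ennreal \<Rightarrow> ennreal" where
  "neg_log r = e2ennreal (- elog r)"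

lemma neg_log_0 [simp]: "neg_log 0 = \<infinity>"
  by (simp add: neg_log_def elog_def)

lemma neg_log_pos: "0 < r \<Longrightarrow> neg_log (ennreal r) = ennreal (- ln r)"
  by (simp add: neg_log_def elog_def ennreal_eq_0_iff not_le)

lemma measurable_elog [measurable]: "elog \<in> borel_measurable borel"
  unfolding elog_def[abs_def] by measurable

lemma measurable_neg_log [measurable]: "neg_log \<in> borel_measurable borel"
  unfolding neg_log_def[abs_def] by measurable

text \<open>
  The tangent inequality \<open>ln u \<le> u - 1\<close> at \<open>u = 1 / (c r)\<close>, rearranged so that all terms are
  nonnegative and only the constant 1 has to be cancelled after integration.
\<close>

lemma (in prob_space) jensen_neg_log:
  assumes [measurable]: "\<rho> \<in> borel_measurable M" and le1: "\<And>x. \<rho> x \<le> 1"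
    and le: "(\<integral>\<^sup>+x. inverse (\<rho> x) \<partial>M) \<le> ennreal c" and "0 \<le> c"
  shows "(\<integral>\<^sup>+x. neg_log (\<rho> x) \<partial>M) \<le> ennreal (ln c)"
proof -
  have "1 = (\<integral>\<^sup>+x. 1 \<partial>M)" by (simp add: emeasure_space_1)
  also have "\<dots> \<le> (\<integral>\<^sup>+x. inverse (\<rho> x) \<partial>M)"
  proof (rule nn_integral_mono)
    fix x show "1 \<le> inverse (\<rho> x)"
    proof (cases "\<rho> x = 0")
      case False
      then obtain r where "\<rho> x = ennreal r" "0 < r" "r \<le> 1"
        using le1[of x] by (cases "\<rho> x") (auto simp: top_unique ennreal_eq_0_iff)
      then show ?thesis by (simp add: inverse_ennreal one_le_inverse flip: ennreal_1)
    qed simp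
  qed
  also note le
  finally have "1 \<le> ennreal c" .
  then have c: "1 \<le> c" using \<open>0 \<le> c\<close> by simp
  have pt: "neg_log (\<rho> x) + 1 \<le> ennreal (1 / c) * inverse (\<rho> x) + ennreal (ln c)" for x
  proof (cases "\<rho> x = 0")
    case True
    then show ?thesis using c by (simp add: ennreal_mult_top)
  next
    case False
    have "\<rho> x \<noteq> \<top>" using le1[of x] by (auto simp: top_unique)
    then obtain r where r: "\<rho> x = ennreal r" "0 \<le> r" by (cases "\<rho> x") auto
    then have "0 < r" "r \<le> 1" using False le1[of x] by auto
    have "ln (1 / (c * r)) \<le> 1 / (c * r) - 1"
      using c \<open>0 < r\<close> by (intro ln_le_minus_one) auto
    then have "- ln r + 1 \<le> 1 / c * inverse r + ln c"
      using c \<open>0 < r\<close> by (simp add: ln_div ln_mult field_simps)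
    have nn: "0 \<le> - ln r" "0 \<le> 1 / c" "0 \<le> inverse r" "0 \<le> ln c"
      using c \<open>0 < r\<close> \<open>r \<le> 1\<close> by auto
    have "neg_log (\<rho> x) + 1 = ennreal (- ln r + 1)"
      using nn \<open>0 < r\<close> by (simp only: r neg_log_pos ennreal_plus ennreal_1 zero_le_one)
    also have "\<dots> \<le> ennreal (1 / c * inverse r + ln c)"
      by (rule ennreal_leI) fact
    also have "\<dots> = ennreal (1 / c) * inverse (\<rho> x) + ennreal (ln c)"
      using nn \<open>0 < r\<close> by (simp only: r inverse_ennreal ennreal_plus ennreal_mult mult_nonneg_nonneg)
    finally show ?thesis .
  qed
  have "(\<integral>\<^sup>+x. neg_log (\<rho> x) \<partial>M) + 1 = (\<integral>\<^sup>+x. neg_log (\<rho> x) + 1 \<partial>M)"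
    by (simp add: nn_integral_add emeasure_space_1)
  also have "\<dots> \<le> (\<integral>\<^sup>+x. ennreal (1 / c) * inverse (\<rho> x) + ennreal (ln c) \<partial>M)"
    by (intro nn_integral_mono pt)
  also have "\<dots> = ennreal (1 / c) * (\<integral>\<^sup>+x. inverse (\<rho> x) \<partial>M) + ennreal (ln c)"
    by (simp add: nn_integral_add nn_integral_cmult emeasure_space_1)
  also have "\<dots> \<le> ennreal (1 / c) * ennreal c + ennreal (ln c)"
    by (intro add_right_mono mult_left_mono le) simp
  also have "\<dots> = ennreal (ln c) + 1"
    using c by (simp add: ennreal_mult[symmetric] add.commute)
  finally show ?thesis by simp
qed

locale tempered_model = S: sigma_finite_measure S + Pi: prob_space Pi
  for S :: "'y measure" and Pi :: "'t measure" +
  fixes L :: "'t \<Rightarrow> 'y \<Rightarrow> real" and Ls :: "'y \<Rightarrow> real" and \<alpha> :: real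
  assumes L_meas: "(\<lambda>(\<theta>, y). L \<theta> y) \<in> borel_measurable (Pi \<Otimes>\<^sub>M S)"
    and Ls_meas[measurable]: "Ls \<in> borel_measurable S"
    and L_nn: "\<And>\<theta> y. 0 \<le> L \<theta> y" and Ls_nn: "\<And>y. 0 \<le> Ls y"
    and \<alpha>: "0 < \<alpha>" "\<alpha> < 1"
begin

lemma L_meas' [measurable (raw)]:
  "f \<in> M \<rightarrow>\<^sub>M Pi \<Longrightarrow> g \<in> M \<rightarrow>\<^sub>M S \<Longrightarrow> (\<lambda>x. L (f x) (g x)) \<in> borel_measurable M"
  using measurable_compose[OF measurable_Pair[of f M Pi g S] L_meas] by simp

sublocale pair_sigma_finite Pi S ..

abbreviation data :: "'y measure" where "data \<equiv> density S (\<lambda>y. ennreal (Ls y))"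

text \<open>
  The Renyi divergence of order \<open>\<alpha>\<close> is \<open>-ln affinity / (1 - \<alpha>)\<close>. The conventions \<open>inverse 0 = \<infinity>\<close> and
  \<open>0 * \<infinity> = 0\<close> of the extended nonnegative reals give the right values for mutually singular densities.
\<close>

definition affinity :: "'t \<Rightarrow> ennreal" where
  "affinity \<theta> = (\<integral>\<^sup>+y. ennreal (L \<theta> y powr \<alpha> * Ls y powr (1 - \<alpha>)) \<partial>S)"

definition tilted_evidence :: "'y \<Rightarrow> ennreal" where
  "tilted_evidence y = (\<integral>\<^sup>+\<theta>. ennreal ((L \<theta> y / Ls y) powr \<alpha>) * inverse (affinity \<theta>) \<partial>Pi)"

definition evidence :: "'y \<Rightarrow> ennreal" where
  "evidence y = (\<integral>\<^sup>+\<theta>. ennreal ((L \<theta> y / Ls y) powr \<alpha>) \<partial>Pi)"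

definition sq_log_ratio :: "'t \<Rightarrow> 'y \<Rightarrow> ennreal" where
  "sq_log_ratio \<theta> y = (if L \<theta> y = 0 then \<infinity> else ennreal ((ln (Ls y / L \<theta> y))\<^sup>2))"

definition local_sq :: "'t set \<Rightarrow> 'y \<Rightarrow> ennreal" where
  "local_sq B y = (\<integral>\<^sup>+\<theta>. sq_log_ratio \<theta> y * indicator B \<theta> \<partial>Pi)"

lemma measurable_affinity [measurable]: "affinity \<in> borel_measurable Pi"
  unfolding affinity_def[abs_def] by measurable

lemma measurable_sq_log_ratio [measurable (raw)]:
  assumes [measurable]: "f \<in> M \<rightarrow>\<^sub>M Pi" "g \<in> M \<rightarrow>\<^sub>M S"
  shows "(\<lambda>x. sq_log_ratio (f x) (g x)) \<in> borel_measurable M"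
  unfolding sq_log_ratio_def by measurable

lemma measurable_tilted_evidence [measurable]: "tilted_evidence \<in> borel_measurable S"
  unfolding tilted_evidence_def[abs_def] by measurable

lemma measurable_local_sq [measurable]:
  assumes [measurable]: "B \<in> sets Pi"
  shows "local_sq B \<in> borel_measurable S"
  unfolding local_sq_def[abs_def] by measurable

lemma affinity_le_1:
  assumes "(\<integral>\<^sup>+y. L \<theta> y \<partial>S) = 1" "(\<integral>\<^sup>+y. Ls y \<partial>S) = 1" and \<theta>: "\<theta> \<in> space Pi"
  shows "affinity \<theta> \<le> 1"
proof -
  have [measurable]: "L \<theta> \<in> borel_measurable S"
    using L_meas'[of "\<lambda>_. \<theta>" S "\<lambda>y. y"] \<theta> by simp
  have "affinity \<theta> \<le> (\<integral>\<^sup>+y. ennreal \<alpha> * ennreal (L \<theta> y) + ennreal (1 - \<alpha>) * ennreal (Ls y) \<partial>S)"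
    unfolding affinity_def
  proof (rule nn_integral_mono)
    fix y
    have "ennreal (L \<theta> y powr \<alpha> * Ls y powr (1 - \<alpha>)) \<le> ennreal (\<alpha> * L \<theta> y + (1 - \<alpha>) * Ls y)"
      by (intro ennreal_leI powr_mult_powr_le_mix L_nn Ls_nn \<alpha>)
    then show "ennreal (L \<theta> y powr \<alpha> * Ls y powr (1 - \<alpha>))
        \<le> ennreal \<alpha> * ennreal (L \<theta> y) + ennreal (1 - \<alpha>) * ennreal (Ls y)"
      using \<alpha> L_nn[of \<theta> y] Ls_nn[of y] by (simp add: ennreal_plus ennreal_mult)
  qed
  also have "\<dots> = ennreal \<alpha> + ennreal (1 - \<alpha>)"
    by (simp add: nn_integral_add nn_integral_cmult assms)
  also have "\<dots> = 1" using \<alpha> by (simp flip: ennreal_plus)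
  finally show ?thesis .
qed

text \<open>
  Under the true density, the tempered likelihood ratio of \<open>\<theta>\<close> has mean at most \<open>affinity \<theta>\<close>. Exchanging
  the integrals cancels the affinity.
\<close>

lemma tilted_evidence_mean: "(\<integral>\<^sup>+y. tilted_evidence y \<partial>data) \<le> 1"
proof -
  have pt: "ennreal (Ls y) * ennreal ((L \<theta> y / Ls y) powr \<alpha>) \<le> ennreal (L \<theta> y powr \<alpha> * Ls y powr (1 - \<alpha>))" for \<theta> y
  proof (cases "Ls y = 0")
    case False
    then have pos: "0 < Ls y" using Ls_nn[of y] by simp
    have "Ls y * (L \<theta> y / Ls y) powr \<alpha> = L \<theta> y powr \<alpha> * Ls y powr (1 - \<alpha>)"
      using pos L_nn[of \<theta> y] by (simp add: powr_divide powr_diff)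
    then show ?thesis using pos by (simp flip: ennreal_mult)
  qed simp
  have "(\<integral>\<^sup>+y. tilted_evidence y \<partial>data) = (\<integral>\<^sup>+y. ennreal (Ls y) * tilted_evidence y \<partial>S)"
    by (simp add: nn_integral_density)
  also have "\<dots> = (\<integral>\<^sup>+y. (\<integral>\<^sup>+\<theta>. ennreal (Ls y) * (ennreal ((L \<theta> y / Ls y) powr \<alpha>) * inverse (affinity \<theta>)) \<partial>Pi) \<partial>S)"
    unfolding tilted_evidence_def
    by (intro nn_integral_cong nn_integral_cmult[symmetric]) measurable
  also have "\<dots> = (\<integral>\<^sup>+\<theta>. (\<integral>\<^sup>+y. ennreal (Ls y) * (ennreal ((L \<theta> y / Ls y) powr \<alpha>) * inverse (affinity \<theta>)) \<partial>S) \<partial>Pi)"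
    by (rule Fubini') measurable
  also have "\<dots> \<le> (\<integral>\<^sup>+\<theta>. (\<integral>\<^sup>+y. inverse (affinity \<theta>) * ennreal (L \<theta> y powr \<alpha> * Ls y powr (1 - \<alpha>)) \<partial>S) \<partial>Pi)"
    using pt by (intro nn_integral_mono) (auto simp: mult.assoc[symmetric] mult.commute[of "inverse _"] intro!: mult_right_mono)
  also have "\<dots> = (\<integral>\<^sup>+\<theta>. inverse (affinity \<theta>) * affinity \<theta> \<partial>Pi)"
    by (intro nn_integral_cong) (simp add: affinity_def nn_integral_cmult)
  also have "\<dots> \<le> (\<integral>\<^sup>+\<theta>. 1 \<partial>Pi)"
  proof (rule nn_integral_mono)
    fix \<theta> show "inverse (affinity \<theta>) * affinity \<theta> \<le> 1"
    proof (cases "affinity \<theta> = 0 \<or> affinity \<theta> = \<top>")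
      case False
      then obtain r where "affinity \<theta> = ennreal r" "0 < r"
        by (cases "affinity \<theta>") (auto simp: ennreal_eq_0_iff)
      then show ?thesis by (simp add: inverse_ennreal ennreal_mult[symmetric])
    qed auto
  qed
  also have "\<dots> = 1" by (simp add: Pi.emeasure_space_1)
  finally show ?thesis .
qed

lemma local_sq_mean:
  assumes [measurable]: "B \<in> sets Pi"
    and var: "\<And>\<theta>. \<theta> \<in> B \<Longrightarrow> (\<integral>\<^sup>+y. ennreal (Ls y) * sq_log_ratio \<theta> y \<partial>S) \<le> a"
  shows "(\<integral>\<^sup>+y. local_sq B y \<partial>data) \<le> a * emeasure Pi B"
proof -
  have "(\<integral>\<^sup>+y. local_sq B y \<partial>data) = (\<integral>\<^sup>+y. ennreal (Ls y) * local_sq B y \<partial>S)"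
    by (simp add: nn_integral_density)
  also have "\<dots> = (\<integral>\<^sup>+y. (\<integral>\<^sup>+\<theta>. ennreal (Ls y) * (sq_log_ratio \<theta> y * indicator B \<theta>) \<partial>Pi) \<partial>S)"
    unfolding local_sq_def by (intro nn_integral_cong nn_integral_cmult[symmetric]) measurable
  also have "\<dots> = (\<integral>\<^sup>+\<theta>. (\<integral>\<^sup>+y. ennreal (Ls y) * (sq_log_ratio \<theta> y * indicator B \<theta>) \<partial>S) \<partial>Pi)"
    by (rule Fubini') measurable
  also have "\<dots> \<le> (\<integral>\<^sup>+\<theta>. a * indicator B \<theta> \<partial>Pi)"
    using var by (intro nn_integral_mono) (auto simp: indicator_def)
  also have "\<dots> = a * emeasure Pi B" by (rule nn_integral_cmult_indicator) simp
  finally show ?thesis .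
qed

text \<open>
  With \<open>l = ln (Ls / L)\<close>, the tangent of \<open>exp(-\<alpha> l)\<close> at \<open>l = t\<close> and
  \<open>l \<le> l\<^sup>2 / (2 t) + t / 2\<close> give the pointwise bound
  \<open>exp(-\<alpha> l) + k l\<^sup>2 \<ge> exp(-\<alpha> t) + k t\<^sup>2\<close> for \<open>k = \<alpha> exp(-\<alpha> t) / (2 t)\<close>. It remains true at
  \<open>l = \<infinity>\<close>, and it turns an upper bound for the second moment of \<open>l\<close> directly into a lower bound for
  the evidence.
\<close>

lemma evidence_lower_bound:
  assumes [measurable]: "B \<in> sets Pi" and y: "y \<in> space S" "0 < Ls y" and "0 < t"
    and sq: "local_sq B y \<le> ennreal (t\<^sup>2) * emeasure Pi B"
  shows "ennreal (exp (- \<alpha> * t)) * emeasure Pi B \<le> evidence y"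
proof -
  let ?e = "exp (- \<alpha> * t)"
  define k where "k = ?e * \<alpha> / (2 * t)"
  let ?z = "\<lambda>\<theta>. ennreal ((L \<theta> y / Ls y) powr \<alpha>)"
  have k: "0 \<le> k" "0 < k" unfolding k_def using \<alpha> \<open>0 < t\<close> by simp_all
  have kt: "k * t\<^sup>2 = ?e * \<alpha> * t / 2"
    unfolding k_def using \<open>0 < t\<close> by (simp add: power2_eq_square)
  have pt: "ennreal (?e + k * t\<^sup>2) \<le> ?z \<theta> + ennreal k * sq_log_ratio \<theta> y" for \<theta>
  proof (cases "L \<theta> y = 0")
    case True
    then show ?thesis using k by (simp add: sq_log_ratio_def ennreal_mult_top ennreal_eq_0_iff)
  next
    case False
    then have pos: "0 < L \<theta> y" using L_nn[of \<theta> y] by simp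
    let ?l = "ln (Ls y / L \<theta> y)"
    have "(L \<theta> y / Ls y) powr \<alpha> = exp (- \<alpha> * ?l)"
      using pos y by (simp add: powr_def ln_div algebra_simps)
    also have "exp (- \<alpha> * ?l) = ?e * exp (- \<alpha> * (?l - t))"
      by (simp add: exp_add[symmetric] algebra_simps)
    also have "\<dots> \<ge> ?e * (1 + - \<alpha> * (?l - t))"
      by (intro mult_left_mono exp_ge_add_one_self) simp
    finally have 1: "?e * (1 + - \<alpha> * (?l - t)) \<le> (L \<theta> y / Ls y) powr \<alpha>" .
    have "?l \<le> ?l\<^sup>2 / (2 * t) + t / 2"
      using zero_le_power2[of "?l - t"] \<open>0 < t\<close> by (simp add: power2_eq_square field_simps)
    then have "?e * \<alpha> * ?l \<le> ?e * \<alpha> * (?l\<^sup>2 / (2 * t) + t / 2)"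
      using \<alpha> by (intro mult_left_mono) auto
    with 1 have "?e + k * t\<^sup>2 \<le> (L \<theta> y / Ls y) powr \<alpha> + k * ?l\<^sup>2"
      unfolding kt by (simp add: k_def algebra_simps add_divide_distrib)
    then have "ennreal (?e + k * t\<^sup>2) \<le> ennreal ((L \<theta> y / Ls y) powr \<alpha> + k * ?l\<^sup>2)" by (rule ennreal_leI)
    also have "\<dots> = ?z \<theta> + ennreal k * ennreal (?l\<^sup>2)"
      using k by (simp only: ennreal_plus ennreal_mult mult_nonneg_nonneg powr_ge_zero zero_le_power2)
    finally show ?thesis using pos by (simp add: sq_log_ratio_def)
  qed
  have fin: "ennreal k * (ennreal (t\<^sup>2) * emeasure Pi B) \<noteq> \<top>"
    by (simp add: ennreal_mult_eq_top_iff)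
  have "ennreal k * (ennreal (t\<^sup>2) * emeasure Pi B) + ennreal ?e * emeasure Pi B
      = ennreal (?e + k * t\<^sup>2) * emeasure Pi B"
    using k by (simp add: ennreal_plus ennreal_mult distrib_right mult.assoc add.commute)
  also have "\<dots> = (\<integral>\<^sup>+\<theta>. ennreal (?e + k * t\<^sup>2) * indicator B \<theta> \<partial>Pi)"
    by (simp add: nn_integral_cmult_indicator)
  also have "\<dots> \<le> (\<integral>\<^sup>+\<theta>. ?z \<theta> + ennreal k * (sq_log_ratio \<theta> y * indicator B \<theta>) \<partial>Pi)"
    using pt by (intro nn_integral_mono) (auto simp: indicator_def)
  also have "\<dots> = evidence y + ennreal k * local_sq B y"
    unfolding evidence_def local_sq_def using y
    by (subst nn_integral_add) (auto simp: nn_integral_cmult)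
  also have "\<dots> \<le> evidence y + ennreal k * (ennreal (t\<^sup>2) * emeasure Pi B)"
    by (intro add_left_mono mult_left_mono sq) simp
  finally show ?thesis
    using fin by (simp add: add.commute[of "evidence y"] ennreal_add_left_cancel_le)
qed

text \<open>
  Jensen's inequality under the tempered posterior, whose density with respect to the prior is the
  tempered likelihood ratio divided by the evidence.
\<close>

lemma tempered_risk_bound:
  assumes y: "y \<in> space S" and aff: "\<And>\<theta>. affinity \<theta> \<le> 1"
    and ev: "ennreal e \<le> evidence y" "0 < e" "evidence y \<noteq> \<infinity>"
    and tilt: "tilted_evidence y \<le> ennreal c" "0 \<le> c"
  shows "(\<integral>\<^sup>+\<theta>. ennreal ((L \<theta> y / Ls y) powr \<alpha>) / evidence y * neg_log (affinity \<theta>) \<partial>Pi)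
    \<le> ennreal (ln (c / e))"
proof -
  let ?w = "\<lambda>\<theta>. ennreal ((L \<theta> y / Ls y) powr \<alpha>) / evidence y"
  have [measurable]: "?w \<in> borel_measurable Pi" using y by measurable
  have ev0: "evidence y \<noteq> 0" using ev by (auto simp: ennreal_eq_0_iff)
  have "(\<integral>\<^sup>+\<theta>. ?w \<theta> \<partial>Pi) = evidence y / evidence y"
    using y unfolding evidence_def[of y, symmetric] divide_ennreal_def
    by (subst nn_integral_multc) (simp_all add: evidence_def)
  also have "\<dots> = 1" using ev0 ev(3) by (simp add: ennreal_divide_self less_top)
  finally interpret Q: prob_space "density Pi ?w"
    by (intro prob_spaceI) (simp add: emeasure_density)
  have "(\<integral>\<^sup>+\<theta>. inverse (affinity \<theta>) \<partial>density Pi ?w)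
      = (\<integral>\<^sup>+\<theta>. ennreal ((L \<theta> y / Ls y) powr \<alpha>) * inverse (affinity \<theta>) * inverse (evidence y) \<partial>Pi)"
    using y by (subst nn_integral_density) (auto simp: divide_ennreal_def mult_ac)
  also have "\<dots> = tilted_evidence y * inverse (evidence y)"
    using y unfolding tilted_evidence_def by (intro nn_integral_multc) measurable
  also have "\<dots> \<le> ennreal c * inverse (ennreal e)"
  proof (intro mult_mono tilt)
    obtain v where "evidence y = ennreal v" "0 \<le> v" using ev(3) by (cases "evidence y") auto
    moreover then have "e \<le> v" using ev by simp
    ultimately show "inverse (evidence y) \<le> inverse (ennreal e)"
      using ev(2) by (simp add: inverse_ennreal le_imp_inverse_le ennreal_leI)
  qed auto
  also have "\<dots> = ennreal (c / e)"
    using ev(2) tilt(2) by (simp add: inverse_ennreal ennreal_mult[symmetric] divide_inverse)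
  finally have "(\<integral>\<^sup>+\<theta>. neg_log (affinity \<theta>) \<partial>density Pi ?w) \<le> ennreal (ln (c / e))"
    using ev(2) tilt(2) by (intro Q.jensen_neg_log) (auto intro: aff)
  then show ?thesis by (subst (asm) nn_integral_density) auto
qed

end

lemma markov_ineq:
  assumes [measurable]: "u \<in> borel_measurable M" and int: "(\<integral>\<^sup>+x. u x \<partial>M) \<le> ennreal s" and k: "0 < k"
  shows "emeasure M {x \<in> space M. \<not> u x \<le> ennreal k} \<le> ennreal (s / k)"
proof -
  have "emeasure M {x \<in> space M. \<not> u x \<le> ennreal k} \<le> emeasure M {x \<in> space M. 1 \<le> ennreal (1 / k) * u x}"
  proof (rule emeasure_mono)
    show "{x \<in> space M. \<not> u x \<le> ennreal k} \<subseteq> {x \<in> space M. 1 \<le> ennreal (1 / k) * u x}"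
    proof safe
      fix x assume "\<not> u x \<le> ennreal k"
      then have "ennreal (1 / k) * ennreal k \<le> ennreal (1 / k) * u x" by (intro mult_left_mono) auto
      then show "1 \<le> ennreal (1 / k) * u x" using k by (simp flip: ennreal_mult)
    qed
  qed measurable
  also have "\<dots> \<le> ennreal (1 / k) * (\<integral>\<^sup>+x. u x * indicator (space M) x \<partial>M)"
    by (rule nn_integral_Markov_inequality) auto
  also have "(\<integral>\<^sup>+x. u x * indicator (space M) x \<partial>M) = (\<integral>\<^sup>+x. u x \<partial>M)"
    by (intro nn_integral_cong) simp
  also have "ennreal (1 / k) * (\<integral>\<^sup>+x. u x \<partial>M) \<le> ennreal (1 / k) * ennreal s"
    by (intro mult_left_mono int) simp
  also have "\<dots> = ennreal (s / k)" using k by (simp add: ennreal_mult'[symmetric])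
  finally show ?thesis .
qed

lemma (in prob_space) good_event:
  assumes ae: "AE x in M. P x" and E[measurable]: "E1 \<in> sets M" "E2 \<in> sets M"
    and p: "emeasure M E1 \<le> ennreal a" "emeasure M E2 \<le> ennreal a" "0 \<le> a"
  shows "\<exists>A\<in>sets M. measure M A \<ge> 1 - 2 * a \<and> (\<forall>x\<in>A. P x \<and> x \<notin> E1 \<and> x \<notin> E2)"
proof -
  obtain N where N: "{x \<in> space M. \<not> P x} \<subseteq> N" "N \<in> null_sets M"
    using ae by (auto elim: AE_E simp: null_sets_def)
  have [measurable]: "N \<in> sets M" and "prob N = 0" using N(2) by (auto simp: measure_def)
  let ?F = "E1 \<union> E2 \<union> N"
  have "prob E1 \<le> a" "prob E2 \<le> a" using p by (simp_all add: emeasure_eq_measure)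
  then have "prob ?F \<le> 2 * a"
    using measure_Un_le[of "E1 \<union> E2" M N] measure_Un_le[of E1 M E2] \<open>prob N = 0\<close> by simp
  then have "prob (space M - ?F) \<ge> 1 - 2 * a" by (subst prob_compl) auto
  then show ?thesis using N(1) by (intro bexI[of _ "space M - ?F"]) auto
qed

section \<open>The i.i.d. model\<close>

locale iid_tempered =
  fixes \<Theta> :: "(real^'d) set" and f :: "real^'d \<Rightarrow> real^'p \<Rightarrow> real" and \<pi> :: "real^'d \<Rightarrow> real"
    and \<theta>s :: "real^'d" and \<alpha> :: real and n :: nat
  assumes model: "parametric_model \<Theta> f" and \<theta>s: "\<theta>s \<in> \<Theta>" and prior: "density_on \<Theta> \<pi>"
    and \<alpha>: "0 < \<alpha>" "\<alpha> < 1"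
begin

text \<open>
  The model is measurable in the parameter only on \<open>\<Theta>\<close>. Sending all other points to \<open>\<theta>s\<close> makes the
  likelihood jointly measurable on the whole space, and it does not affect integrals against the
  prior, which vanishes outside \<open>\<Theta>\<close>.
\<close>

definition to_param :: "real^'d \<Rightarrow> real^'d" where
  "to_param \<theta> = (if \<theta> \<in> \<Theta> then \<theta> else \<theta>s)"

abbreviation lik :: "real^'d \<Rightarrow> (nat \<Rightarrow> real^'p) \<Rightarrow> real" where
  "lik \<theta> Y \<equiv> joint_density f n (to_param \<theta>) Y"

lemma to_param: "to_param \<theta> \<in> \<Theta>" "\<theta> \<in> \<Theta> \<Longrightarrow> to_param \<theta> = \<theta>"
  using \<theta>s by (auto simp: to_param_def)

lemma \<Theta>_meas [measurable]: "\<Theta> \<in> sets borel"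
  using model by (simp add: parametric_model_def)

lemma prior_meas [measurable]: "\<pi> \<in> borel_measurable borel"
  and prior_nonneg: "0 \<le> \<pi> \<theta>" and prior_off: "\<theta> \<notin> \<Theta> \<Longrightarrow> \<pi> \<theta> = 0"
  and prior_mass: "(\<integral>\<^sup>+\<theta>. \<pi> \<theta> \<partial>lborel) = 1"
  using prior by (auto simp: density_on_def)

lemma lik_nonneg: "\<theta> \<in> \<Theta> \<Longrightarrow> 0 \<le> joint_density f n \<theta> Y"
  using model by (auto simp: parametric_model_def joint_density_def intro!: prod_nonneg)

lemma measurable_to_param [measurable]: "to_param \<in> borel \<rightarrow>\<^sub>M restrict_space borel \<Theta>"
proof (rule measurable_restrict_space2)
  show "to_param \<in> borel \<rightarrow>\<^sub>M borel" unfolding to_param_def[abs_def] by measurable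
qed (use to_param in auto)

lemma measurable_lik [measurable (raw)]:
  assumes g: "g \<in> M \<rightarrow>\<^sub>M borel" and h: "h \<in> M \<rightarrow>\<^sub>M sample_lebesgue n"
  shows "(\<lambda>x. lik (g x) (h x)) \<in> borel_measurable M"
  unfolding joint_density_def
proof (rule borel_measurable_prod)
  fix i assume "i \<in> {..<n}"
  then have "(\<lambda>x. h x i) \<in> M \<rightarrow>\<^sub>M borel"
    using measurable_compose[OF h, of "\<lambda>Y. Y i" borel]
      measurable_component_singleton[of i "{..<n}" "\<lambda>_. lborel :: (real^'p) measure"]
    by (simp add: sample_lebesgue_def)
  moreover have "(\<lambda>x. to_param (g x)) \<in> M \<rightarrow>\<^sub>M restrict_space borel \<Theta>"
    using g by measurable
  ultimately have "(\<lambda>x. (to_param (g x), h x i)) \<in> M \<rightarrow>\<^sub>M restrict_space borel \<Theta> \<Otimes>\<^sub>M borel"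
    by (rule measurable_Pair[rotated])
  then show "(\<lambda>x. f (to_param (g x)) (h x i)) \<in> borel_measurable M"
    using model measurable_compose[of _ M "restrict_space borel \<Theta> \<Otimes>\<^sub>M borel" "\<lambda>(\<theta>, y). f \<theta> y" borel]
    by (auto simp: parametric_model_def)
qed

lemma measurable_true_lik [measurable]: "joint_density f n \<theta>s \<in> borel_measurable (sample_lebesgue n)"
  using measurable_lik[of "\<lambda>_. \<theta>s" "sample_lebesgue n" "\<lambda>Y. Y"] \<theta>s by (simp add: to_param)

lemma sigma_finite_sample: "sigma_finite_measure (sample_lebesgue n :: (nat \<Rightarrow> real^'p) measure)"
proof -
  interpret product_sigma_finite "\<lambda>_::nat. lborel :: (real^'p) measure" ..
  show ?thesis unfolding sample_lebesgue_def by (rule sigma_finite) simp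
qed

lemma lik_mass:
  assumes "\<theta> \<in> \<Theta>"
  shows "(\<integral>\<^sup>+Y. joint_density f n \<theta> Y \<partial>sample_lebesgue n) = 1"
proof -
  interpret product_sigma_finite "\<lambda>_::nat. lborel :: (real^'p) measure" ..
  have nn: "0 \<le> f \<theta> y" and mass: "(\<integral>\<^sup>+y. f \<theta> y \<partial>lborel) = 1" for y
    using model assms by (auto simp: parametric_model_def)
  have [measurable]: "f \<theta> \<in> borel_measurable borel"
  proof -
    have "(\<lambda>y. (\<theta>, y)) \<in> borel \<rightarrow>\<^sub>M restrict_space borel \<Theta> \<Otimes>\<^sub>M borel"
      using assms by (intro measurable_Pair1') (simp add: space_restrict_space)
    from measurable_compose[OF this, of "\<lambda>(\<theta>, y). f \<theta> y" borel] show ?thesis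
      using model by (simp add: parametric_model_def)
  qed
  have "(\<integral>\<^sup>+Y. joint_density f n \<theta> Y \<partial>sample_lebesgue n)
      = (\<integral>\<^sup>+Y. (\<Prod>i<n. ennreal (f \<theta> (Y i))) \<partial>(\<Pi>\<^sub>M i\<in>{..<n}. lborel))"
    unfolding sample_lebesgue_def joint_density_def by (simp add: prod_ennreal nn)
  also have "\<dots> = (\<Prod>i<n. (\<integral>\<^sup>+y. f \<theta> y \<partial>lborel))"
    by (rule product_nn_integral_prod) auto
  finally show ?thesis by (simp add: mass)
qed

sublocale tempered_model "sample_lebesgue n" "dist_of \<pi>" lik "joint_density f n \<theta>s" \<alpha>
proof -
  interpret S: sigma_finite_measure "sample_lebesgue n :: (nat \<Rightarrow> real^'p) measure"
    by (rule sigma_finite_sample)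
  interpret Pi: prob_space "dist_of \<pi>"
    by (rule prob_spaceI) (simp add: dist_of_def emeasure_density prior_mass)
  show "tempered_model (sample_lebesgue n) (dist_of \<pi>) lik (joint_density f n \<theta>s) \<alpha>"
  proof unfold_locales
    have "sets (dist_of \<pi> \<Otimes>\<^sub>M sample_lebesgue n) = sets (borel \<Otimes>\<^sub>M sample_lebesgue n)"
      by (intro sets_pair_measure_cong) (simp_all add: dist_of_def)
    moreover have "(\<lambda>(\<theta>, y). lik \<theta> y) \<in> borel_measurable (borel \<Otimes>\<^sub>M sample_lebesgue n)"
      by measurable
    ultimately show "(\<lambda>(\<theta>, y). lik \<theta> y) \<in> borel_measurable (dist_of \<pi> \<Otimes>\<^sub>M sample_lebesgue n)"
      using measurable_cong_sets[of "dist_of \<pi> \<Otimes>\<^sub>M sample_lebesgue n" "borel \<Otimes>\<^sub>M sample_lebesgue n" borel borel]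
      by blast
  qed (use \<alpha> lik_nonneg to_param \<theta>s in auto)
qed


lemma integral_dist_prior:
  assumes [measurable]: "g \<in> borel_measurable borel"
  shows "(\<integral>\<^sup>+\<theta>. g \<theta> \<partial>dist_of \<pi>) = (\<integral>\<^sup>+\<theta>. ennreal (\<pi> \<theta>) * g \<theta> \<partial>lborel)"
  unfolding dist_of_def by (rule nn_integral_density) auto

lemma frac_post_eq:
  "frac_post \<Theta> f \<pi> \<alpha> n Y \<theta> = lik \<theta> Y powr \<alpha> * \<pi> \<theta> / (\<integral>\<theta>. lik \<theta> Y powr \<alpha> * \<pi> \<theta> \<partial>lborel)"
proof -
  have eq: "joint_density f n \<theta> Y powr \<alpha> * \<pi> \<theta> = lik \<theta> Y powr \<alpha> * \<pi> \<theta>" for \<theta>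
    using prior_off[of \<theta>] to_param(2)[of \<theta>] by (cases "\<theta> \<in> \<Theta>") auto
  have ind: "indicator \<Theta> \<theta> *\<^sub>R (lik \<theta> Y powr \<alpha> * \<pi> \<theta>) = lik \<theta> Y powr \<alpha> * \<pi> \<theta>" for \<theta>
    using prior_off[of \<theta>] by (cases "\<theta> \<in> \<Theta>") auto
  show ?thesis
    unfolding frac_post_def set_lebesgue_integral_def eq ind ..
qed

text \<open>
  The normalising integral in the definition of the fractional posterior is 0 if it diverges. Then the
  posterior density would vanish identically and no density could have finite divergence from it.
\<close>

lemma minimizer_is_posterior:
  assumes Y: "Y \<in> space (sample_lebesgue n)" and pos: "0 < joint_density f n \<theta>s Y"
    and min: "is_finite_arg_min (\<lambda>q. kl_div lborel q (frac_post \<Theta> f \<pi> \<alpha> n Y)) Q_GP q"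
  shows "evidence Y \<noteq> \<infinity>"
    and "AE \<theta> in lborel. ennreal (q \<theta>)
      = ennreal (\<pi> \<theta>) * (ennreal ((lik \<theta> Y / joint_density f n \<theta>s Y) powr \<alpha>) / evidence Y)"
proof -
  let ?Ls = "joint_density f n \<theta>s Y" and ?X = "\<lambda>\<theta>. lik \<theta> Y powr \<alpha> * \<pi> \<theta>"
  let ?p = "frac_post \<Theta> f \<pi> \<alpha> n Y"
  define Z where "Z = (\<integral>\<theta>. ?X \<theta> \<partial>lborel)"
  have p_eq: "?p = (\<lambda>\<theta>. ?X \<theta> / Z)"
    by (rule ext) (simp add: frac_post_eq Z_def)
  have X_nn: "0 \<le> ?X \<theta>" for \<theta> using prior_nonneg[of \<theta>] by simp
  then have "0 \<le> Z" unfolding Z_def by (intro Bochner_Integration.integral_nonneg)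
  have X_meas[measurable]: "?X \<in> borel_measurable borel" using Y by measurable
  have p_meas: "?p \<in> borel_measurable borel" unfolding p_eq by measurable
  have p_nn: "0 \<le> ?p \<theta>" for \<theta> using X_nn[of \<theta>] \<open>0 \<le> Z\<close> by (simp add: p_eq)
  have q: "q \<in> Q_GP" and fin: "\<bar>kl_div lborel q ?p\<bar> \<noteq> \<infinity>"
    using min by (auto simp: is_finite_arg_min_def is_arg_min_def)
  have "Z \<noteq> 0"
  proof
    assume "Z = 0"
    have "AE \<theta> in lborel. 0 < ?p \<theta>"
      by (rule kl_div_finiteD(1)[OF Q_GP_facts(1)[OF q] p_meas Q_GP_facts(2)[OF q] p_nn fin])
    then have "AE \<theta> in (lborel :: (real^'d) measure). False" by (simp add: p_eq \<open>Z = 0\<close>)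
    then show False by (simp add: AE_iff_null null_sets_def)
  qed
  then have "0 < Z" using \<open>0 \<le> Z\<close> by simp
  have X_int: "integrable lborel ?X"
    using \<open>Z \<noteq> 0\<close> not_integrable_integral_eq unfolding Z_def by blast
  have "(\<integral>\<theta>. ?p \<theta> \<partial>lborel) = 1" using \<open>Z \<noteq> 0\<close> by (simp add: p_eq Z_def)
  from Q_GP_minimizer_eq_target[OF p_meas p_nn this min]
  have q_eq: "AE \<theta> in lborel. q \<theta> = ?p \<theta>" .
  have ratio: "ennreal (\<pi> \<theta>) * ennreal ((lik \<theta> Y / ?Ls) powr \<alpha>) = ennreal (1 / ?Ls powr \<alpha>) * ennreal (?X \<theta>)" for \<theta>
    using pos prior_nonneg[of \<theta>] lik_nonneg[OF to_param(1)]
    by (simp add: powr_divide ennreal_mult'[symmetric] ennreal_mult''[symmetric] mult_ac)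
  have "evidence Y = (\<integral>\<^sup>+\<theta>. ennreal (1 / ?Ls powr \<alpha>) * ennreal (?X \<theta>) \<partial>lborel)"
    unfolding evidence_def using Y by (subst integral_dist_prior) (auto simp: ratio)
  also have "\<dots> = ennreal (1 / ?Ls powr \<alpha>) * ennreal Z"
    unfolding Z_def using X_int X_nn by (simp add: nn_integral_cmult nn_integral_eq_integral)
  also have "\<dots> = ennreal (Z / ?Ls powr \<alpha>)"
    using \<open>0 < Z\<close> by (simp add: ennreal_mult'[symmetric])
  finally have ev: "evidence Y = ennreal (Z / ?Ls powr \<alpha>)" .
  then show "evidence Y \<noteq> \<infinity>" by simp
  have "ennreal (?p \<theta>) = ennreal (\<pi> \<theta>) * (ennreal ((lik \<theta> Y / ?Ls) powr \<alpha>) / evidence Y)" for \<theta>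
  proof -
    have "ennreal (\<pi> \<theta>) * (ennreal ((lik \<theta> Y / ?Ls) powr \<alpha>) / evidence Y)
        = ennreal (1 / ?Ls powr \<alpha>) * ennreal (?X \<theta>) / ennreal (Z / ?Ls powr \<alpha>)"
      unfolding ratio[symmetric] ev by (simp add: divide_ennreal_def mult.assoc)
    also have "\<dots> = ennreal (1 / ?Ls powr \<alpha> * ?X \<theta>) / ennreal (Z / ?Ls powr \<alpha>)"
      using X_nn[of \<theta>] by (subst ennreal_mult) auto
    also have "\<dots> = ennreal (1 / ?Ls powr \<alpha> * ?X \<theta> / (Z / ?Ls powr \<alpha>))"
      using X_nn[of \<theta>] pos \<open>0 < Z\<close> by (intro divide_ennreal) auto
    also have "1 / ?Ls powr \<alpha> * ?X \<theta> / (Z / ?Ls powr \<alpha>) = ?p \<theta>"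
      using pos by (simp add: p_eq)
    finally show ?thesis by simp
  qed
  with q_eq show "AE \<theta> in lborel. ennreal (q \<theta>)
      = ennreal (\<pi> \<theta>) * (ennreal ((lik \<theta> Y / ?Ls) powr \<alpha>) / evidence Y)"
    by (auto elim!: eventually_mono)
qed

lemma affinity_le: "affinity \<theta> \<le> 1"
  using lik_mass[OF to_param(1)] lik_mass[OF \<theta>s]
  by (intro affinity_le_1) (simp_all add: dist_of_def)

lemma renyi_integrand:
  assumes \<theta>: "\<theta> \<in> \<Theta>" and "0 < q" and n: "1 \<le> n"
  shows "ereal (1 / real n) * renyi_div \<alpha> (sample_lebesgue n) (joint_density f n \<theta>) (joint_density f n \<theta>s) * ereal q
    = enn2ereal (ennreal (1 / (real n * (1 - \<alpha>))) * (neg_log (affinity \<theta>) * ennreal q))"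
proof -
  have ren: "renyi_div \<alpha> (sample_lebesgue n) (joint_density f n \<theta>) (joint_density f n \<theta>s)
      = ereal (1 / (\<alpha> - 1)) * elog (affinity \<theta>)"
    by (simp add: renyi_div_def affinity_def to_param(2)[OF \<theta>])
  have k: "0 < 1 / (real n * (1 - \<alpha>))" "\<not> real n * (1 - \<alpha>) \<le> 0"
    using \<alpha> n by (simp_all add: not_le)
  show ?thesis
  proof (cases "affinity \<theta> = 0")
    case True
    then show ?thesis
      using \<alpha> n \<open>0 < q\<close> k
      by (simp add: ren elog_def ennreal_mult_top ennreal_top_mult ennreal_eq_0_iff)
  next
    case False
    then obtain r where r: "affinity \<theta> = ennreal r" "0 < r" "r \<le> 1"
      using affinity_le[of \<theta>] by (cases "affinity \<theta>") (auto simp: top_unique ennreal_eq_0_iff)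
    have nn: "0 \<le> - ln r" "0 \<le> q" "0 \<le> 1 / (real n * (1 - \<alpha>))" using r \<open>0 < q\<close> k by auto
    have "ennreal (1 / (real n * (1 - \<alpha>))) * (neg_log (affinity \<theta>) * ennreal q)
        = ennreal (1 / (real n * (1 - \<alpha>)) * (- ln r * q))"
      using nn by (simp only: r(1) neg_log_pos[OF r(2)] ennreal_mult mult_nonneg_nonneg)
    then have "enn2ereal (ennreal (1 / (real n * (1 - \<alpha>))) * (neg_log (affinity \<theta>) * ennreal q))
        = ereal (1 / (real n * (1 - \<alpha>)) * (- ln r * q))"
      using nn by (simp only: enn2ereal_ennreal mult_nonneg_nonneg)
    also have "1 / (real n * (1 - \<alpha>)) * (- ln r * q) = 1 / real n * (1 / (\<alpha> - 1) * ln r) * q"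
      using \<alpha> n by (simp add: field_simps)
    finally show ?thesis using r by (simp add: ren elog_def ennreal_eq_0_iff not_le)
  qed
qed

lemma kl_var_eq:
  assumes "\<theta> \<in> \<Theta>"
  shows "kl_var (sample_lebesgue n) (joint_density f n \<theta>s) (joint_density f n \<theta>)
    = enn2ereal (\<integral>\<^sup>+Y. ennreal (joint_density f n \<theta>s Y) * sq_log_ratio \<theta> Y \<partial>sample_lebesgue n)"
proof -
  let ?g = "\<lambda>Y. ereal (joint_density f n \<theta>s Y)
    * (elog (ennreal (joint_density f n \<theta>s Y) / ennreal (joint_density f n \<theta> Y)))\<^sup>2"
  have g: "?g Y = enn2ereal (ennreal (joint_density f n \<theta>s Y) * sq_log_ratio \<theta> Y)" for Y
  proof -
    let ?a = "joint_density f n \<theta>s Y" and ?b = "joint_density f n \<theta> Y"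
    have ab: "0 \<le> ?a" "0 \<le> ?b" using lik_nonneg \<theta>s assms by auto
    consider "?a = 0" | "0 < ?a" "?b = 0" | "0 < ?a" "0 < ?b" using ab by fastforce
    then show ?thesis
    proof cases
      case 1
      then show ?thesis by (simp add: zero_ennreal.rep_eq flip: zero_ereal_def)
    next
      case 2
      then have "ennreal ?a / ennreal ?b = \<infinity>"
        by (simp add: ennreal_divide_zero ennreal_eq_0_iff)
      then show ?thesis
        using 2 by (simp add: elog_def sq_log_ratio_def to_param(2)[OF assms] ennreal_mult_top ennreal_eq_0_iff power2_eq_square)
    next
      case 3
      then have "elog (ennreal ?a / ennreal ?b) = ereal (ln (?a / ?b))"
        by (simp add: elog_def divide_ennreal ennreal_eq_0_iff not_le)
      then show ?thesis
        using 3 by (simp add: sq_log_ratio_def to_param(2)[OF assms] ennreal_mult[symmetric] enn2ereal_ennreal power2_eq_square)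
    qed
  qed
  have "e2ennreal (- ?g Y) = 0" for Y unfolding g by (rule e2ennreal_neg) simp
  moreover have "e2ennreal (?g Y) = ennreal (joint_density f n \<theta>s Y) * sq_log_ratio \<theta> Y" for Y
    unfolding g by simp
  ultimately show ?thesis
    unfolding kl_var_def eintegral_def by (simp add: zero_ennreal.rep_eq)
qed

lemma data_measure_eq: "data_measure f n \<theta>s = data"
  by (simp add: data_measure_def)

lemma prob_space_data: "prob_space data"
  by (rule prob_spaceI) (simp add: emeasure_density lik_mass[OF \<theta>s])

text \<open>
  The affinity is at most 1, so the Renyi divergence is nonnegative and the extended integral has no
  negative part. For the same reason the evidence is at most the tilted evidence, so the bound
  \<open>ln (c / e)\<close> is nonnegative.
\<close>

lemma risk_le_of_evidence:
  assumes Y: "Y \<in> space (sample_lebesgue n)" and pos: "0 < joint_density f n \<theta>s Y" and n: "1 \<le> n"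
    and min: "is_finite_arg_min (\<lambda>q. kl_div lborel q (frac_post \<Theta> f \<pi> \<alpha> n Y)) Q_GP q"
    and ev: "ennreal e \<le> evidence Y" "0 < e"
    and tilt: "tilted_evidence Y \<le> ennreal c" "0 < c"
  shows "eintegral (restrict_space lborel \<Theta>)
      (\<lambda>\<theta>. ereal (1 / real n)
        * renyi_div \<alpha> (sample_lebesgue n) (joint_density f n \<theta>) (joint_density f n \<theta>s) * ereal (q \<theta>))
    \<le> ereal (1 / (real n * (1 - \<alpha>)) * ln (c / e))"
proof -
  let ?g = "\<lambda>\<theta>. ereal (1 / real n)
        * renyi_div \<alpha> (sample_lebesgue n) (joint_density f n \<theta>) (joint_density f n \<theta>s) * ereal (q \<theta>)"
  define k where "k = 1 / (real n * (1 - \<alpha>))"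
  have k: "0 \<le> k" using \<alpha> by (simp add: k_def)
  have q: "q \<in> Q_GP" using min by (auto simp: is_finite_arg_min_def is_arg_min_def)
  note [measurable] = Q_GP_facts(1)[OF q]
  note post = minimizer_is_posterior[OF Y pos min]
  let ?w = "\<lambda>\<theta>. ennreal ((lik \<theta> Y / joint_density f n \<theta>s Y) powr \<alpha>) / evidence Y"
  have [measurable]: "?w \<in> borel_measurable borel" using Y by measurable
  have g: "?g \<theta> = enn2ereal (ennreal k * (neg_log (affinity \<theta>) * ennreal (q \<theta>)))" if "\<theta> \<in> \<Theta>" for \<theta>
    using renyi_integrand[OF that Q_GP_facts(2)[OF q] n] by (simp add: k_def)
  have aff: "affinity \<in> borel_measurable borel"
    using measurable_affinity by (simp add: dist_of_def)
  note [measurable] = aff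
  have "(\<integral>\<^sup>+\<theta>. neg_log (affinity \<theta>) * ennreal (q \<theta>) \<partial>lborel)
      = (\<integral>\<^sup>+\<theta>. ennreal (\<pi> \<theta>) * (?w \<theta> * neg_log (affinity \<theta>)) \<partial>lborel)"
    using post(2) by (intro nn_integral_cong_AE) (auto elim!: eventually_mono simp: mult_ac)
  also have "\<dots> = (\<integral>\<^sup>+\<theta>. ?w \<theta> * neg_log (affinity \<theta>) \<partial>dist_of \<pi>)"
    by (rule integral_dist_prior[symmetric]) measurable
  also have "\<dots> \<le> ennreal (ln (c / e))"
    using tilt ev post(1) by (intro tempered_risk_bound[OF Y affinity_le]) auto
  finally have risk: "(\<integral>\<^sup>+\<theta>. neg_log (affinity \<theta>) * ennreal (q \<theta>) \<partial>lborel) \<le> ennreal (ln (c / e))" .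
  have \<Theta>_sp: "space (restrict_space lborel \<Theta>) = \<Theta>" by (simp add: space_restrict_space)
  have neg: "(\<integral>\<^sup>+\<theta>. e2ennreal (- ?g \<theta>) \<partial>restrict_space lborel \<Theta>) = 0"
  proof -
    have "(\<integral>\<^sup>+\<theta>. e2ennreal (- ?g \<theta>) \<partial>restrict_space lborel \<Theta>) = (\<integral>\<^sup>+\<theta>. 0 \<partial>restrict_space lborel \<Theta>)"
    proof (rule nn_integral_cong)
      fix \<theta> assume "\<theta> \<in> space (restrict_space lborel \<Theta>)"
      then have "\<theta> \<in> \<Theta>" by (simp only: \<Theta>_sp)
      then show "e2ennreal (- ?g \<theta>) = 0" unfolding g[OF \<open>\<theta> \<in> \<Theta>\<close>] by (intro e2ennreal_neg) simp
    qed
    then show ?thesis by simp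
  qed
  have "(\<integral>\<^sup>+\<theta>. e2ennreal (?g \<theta>) \<partial>restrict_space lborel \<Theta>)
      = (\<integral>\<^sup>+\<theta>. ennreal k * (neg_log (affinity \<theta>) * ennreal (q \<theta>)) \<partial>restrict_space lborel \<Theta>)"
  proof (rule nn_integral_cong)
    fix \<theta> assume "\<theta> \<in> space (restrict_space lborel \<Theta>)"
    then have "\<theta> \<in> \<Theta>" by (simp only: \<Theta>_sp)
    then show "e2ennreal (?g \<theta>) = ennreal k * (neg_log (affinity \<theta>) * ennreal (q \<theta>))"
      unfolding g[OF \<open>\<theta> \<in> \<Theta>\<close>] by simp
  qed
  also have "\<dots> \<le> (\<integral>\<^sup>+\<theta>. ennreal k * (neg_log (affinity \<theta>) * ennreal (q \<theta>)) \<partial>lborel)"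
    by (subst nn_integral_restrict_space) (auto intro!: nn_integral_mono simp: indicator_def)
  also have "\<dots> = ennreal k * (\<integral>\<^sup>+\<theta>. neg_log (affinity \<theta>) * ennreal (q \<theta>) \<partial>lborel)"
    by (intro nn_integral_cmult) measurable
  also have "\<dots> \<le> ennreal k * ennreal (ln (c / e))"
    by (intro mult_left_mono risk) simp
  also have "\<dots> = ennreal (k * ln (c / e))" using k by (simp add: ennreal_mult')
  finally have pos_part: "(\<integral>\<^sup>+\<theta>. e2ennreal (?g \<theta>) \<partial>restrict_space lborel \<Theta>) \<le> ennreal (k * ln (c / e))" .
  have "0 \<le> ln (c / e)"
  proof -
    have "1 \<le> c / e"
    proof -
      have "evidence Y \<le> tilted_evidence Y"
        unfolding evidence_def tilted_evidence_def
      proof (rule nn_integral_mono)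
        fix \<theta>
        have "1 \<le> inverse (affinity \<theta>)"
        proof (cases "affinity \<theta> = 0")
          case False
          then obtain r where "affinity \<theta> = ennreal r" "0 < r" "r \<le> 1"
            using affinity_le[of \<theta>] by (cases "affinity \<theta>") (auto simp: top_unique ennreal_eq_0_iff)
          then show ?thesis by (simp add: inverse_ennreal one_le_inverse flip: ennreal_1)
        qed simp
        from mult_left_mono[OF this, of "ennreal ((lik \<theta> Y / joint_density f n \<theta>s Y) powr \<alpha>)"]
        show "ennreal ((lik \<theta> Y / joint_density f n \<theta>s Y) powr \<alpha>)
          \<le> ennreal ((lik \<theta> Y / joint_density f n \<theta>s Y) powr \<alpha>) * inverse (affinity \<theta>)" by simp
      qed
      then have "ennreal e \<le> ennreal c" using ev(1) tilt(1) by (meson order_trans)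
      then show ?thesis using ev(2) tilt(2) by simp
    qed
    then show ?thesis by simp
  qed
  then have "0 \<le> k * ln (c / e)" using k by simp
  have "eintegral (restrict_space lborel \<Theta>) ?g
      = enn2ereal (\<integral>\<^sup>+\<theta>. e2ennreal (?g \<theta>) \<partial>restrict_space lborel \<Theta>)"
    unfolding eintegral_def neg by (simp add: zero_ennreal.rep_eq)
  also have "\<dots> \<le> enn2ereal (ennreal (k * ln (c / e)))"
    using pos_part by (simp add: less_eq_ennreal.rep_eq)
  also have "\<dots> = ereal (k * ln (c / e))"
    using \<open>0 \<le> k * ln (c / e)\<close> by (simp add: enn2ereal_ennreal)
  finally show ?thesis by (simp add: k_def)
qed

text \<open>
  If the prior gives mass 0 to the neighbourhood, the bound is \<open>\<infinity>\<close>. Otherwise the neighbourhood is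
  measurable, as nonmeasurable sets get the value 0.
\<close>

lemma finite_sample_bound:
  fixes \<epsilon> D :: real
  assumes \<epsilon>: "0 < \<epsilon>" and D: "1 < D" and n: "1 \<le> n"
    and P: "AE Y in data. is_finite_arg_min (\<lambda>q. kl_div lborel q (frac_post \<Theta> f \<pi> \<alpha> n Y)) Q_GP (qhat Y)"
  shows "\<exists>A \<in> sets data. measure data A \<ge> 1 - 2 / ((D - 1)\<^sup>2 * real n * \<epsilon>\<^sup>2) \<and>
       (\<forall>Y\<in>A.
          eintegral (restrict_space lborel \<Theta>)
            (\<lambda>\<theta>. ereal (1 / real n)
               * renyi_div \<alpha> (sample_lebesgue n) (joint_density f n \<theta>) (joint_density f n \<theta>s)
               * ereal (qhat Y \<theta>))
          \<le> ereal (D * \<alpha> / (1 - \<alpha>) * \<epsilon>\<^sup>2)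
             + ereal (1 / (real n * (1 - \<alpha>))) * elog (inverse (emeasure (dist_of \<pi>) (B_set \<Theta> f n \<theta>s \<epsilon>)))
             + ereal ((ln ((D - 1)\<^sup>2 / \<alpha>) - 1) / (1 - \<alpha>) * (1 / real n)))"
proof -
  interpret data: prob_space data by (rule prob_space_data)
  let ?B = "B_set \<Theta> f n \<theta>s \<epsilon>"
  define b where "b = measure (dist_of \<pi>) ?B"
  have b_em: "emeasure (dist_of \<pi>) ?B = ennreal b" by (simp add: b_def Pi.emeasure_eq_measure)
  define a where "a = real n * \<epsilon>\<^sup>2"
  have a: "0 < a" using \<epsilon> n by (simp add: a_def)
  \<comment> \<open>the thresholds \<open>c\<close> and \<open>t\<close> give both Markov bounds the failure probability \<open>1 / c\<close>\<close>
  define c where "c = (D - 1)\<^sup>2 * a"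
  have c: "0 < c" using D a by (simp add: c_def)
  define t where "t = (D - 1) * a"
  have t: "0 < t" using D a by (simp add: t_def)
  have fail: "2 / ((D - 1)\<^sup>2 * real n * \<epsilon>\<^sup>2) = 2 * (1 / c)" by (simp add: c_def a_def mult.assoc)
  show ?thesis
  proof (cases "b = 0")
    case True
    have "0 < 1 / (real n * (1 - \<alpha>))" using \<alpha> n by simp
    then have "ereal (1 / (real n * (1 - \<alpha>))) * elog (inverse (emeasure (dist_of \<pi>) ?B)) = \<infinity>"
      unfolding b_em True using \<alpha> n by (simp add: elog_def)
    moreover have "1 - 2 / ((D - 1)\<^sup>2 * real n * \<epsilon>\<^sup>2) \<le> measure data (space data)"
      unfolding fail using c by (simp only: data.prob_space) simp
    ultimately show ?thesis by (intro bexI[of _ "space data"]) auto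
  next
    case False
    then have b: "0 < b" by (simp add: b_def zero_less_measure_iff)
    have B[measurable]: "?B \<in> sets (dist_of \<pi>)"
      using b b_em emeasure_notin_sets[of ?B "dist_of \<pi>"] by (cases "?B \<in> sets (dist_of \<pi>)") auto
    have var: "(\<integral>\<^sup>+Y. ennreal (joint_density f n \<theta>s Y) * sq_log_ratio \<theta> Y \<partial>sample_lebesgue n) \<le> ennreal a"
      if "\<theta> \<in> ?B" for \<theta>
    proof -
      have "\<theta> \<in> \<Theta>" "kl_var (sample_lebesgue n) (joint_density f n \<theta>s) (joint_density f n \<theta>) \<le> ereal a"
        using that by (auto simp: B_set_def a_def)
      then have "enn2ereal (\<integral>\<^sup>+Y. ennreal (joint_density f n \<theta>s Y) * sq_log_ratio \<theta> Y \<partial>sample_lebesgue n)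
          \<le> enn2ereal (ennreal a)"
        using a by (simp add: kl_var_eq enn2ereal_ennreal)
      then show ?thesis by (simp add: less_eq_ennreal.rep_eq)
    qed
    let ?E1 = "{Y \<in> space data. \<not> tilted_evidence Y \<le> ennreal c}"
    let ?E2 = "{Y \<in> space data. \<not> local_sq ?B Y \<le> ennreal (t\<^sup>2 * b)}"
    have E1: "emeasure data ?E1 \<le> ennreal (1 / c)"
      using markov_ineq[of tilted_evidence data 1 c] tilted_evidence_mean c by simp
    have "(\<integral>\<^sup>+Y. local_sq ?B Y \<partial>data) \<le> ennreal (a * b)"
      using local_sq_mean[OF B var] a b by (simp add: b_em ennreal_mult)
    then have "emeasure data ?E2 \<le> ennreal (a * b / (t\<^sup>2 * b))"
      using t b by (intro markov_ineq) auto
    also have "a * b / (t\<^sup>2 * b) = 1 / c"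
      using a b D by (simp add: t_def c_def power2_eq_square)
    finally have E2: "emeasure data ?E2 \<le> ennreal (1 / c)" .
    have true_pos: "AE Y in data. 0 < joint_density f n \<theta>s Y"
      by (subst AE_density) (auto simp: ennreal_eq_0_iff not_le)
    have ae: "AE Y in data. is_finite_arg_min (\<lambda>q. kl_div lborel q (frac_post \<Theta> f \<pi> \<alpha> n Y)) Q_GP (qhat Y)
        \<and> 0 < joint_density f n \<theta>s Y \<and> Y \<in> space data"
      using P true_pos AE_space by eventually_elim auto
    obtain A where A: "A \<in> sets data" "measure data A \<ge> 1 - 2 * (1 / c)"
      and good: "\<And>Y. Y \<in> A \<Longrightarrow> (is_finite_arg_min (\<lambda>q. kl_div lborel q (frac_post \<Theta> f \<pi> \<alpha> n Y)) Q_GP (qhat Y)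
        \<and> 0 < joint_density f n \<theta>s Y \<and> Y \<in> space data) \<and> Y \<notin> ?E1 \<and> Y \<notin> ?E2"
      using data.good_event[OF ae _ _ E1 E2] c by auto
    have "eintegral (restrict_space lborel \<Theta>)
            (\<lambda>\<theta>. ereal (1 / real n)
               * renyi_div \<alpha> (sample_lebesgue n) (joint_density f n \<theta>) (joint_density f n \<theta>s)
               * ereal (qhat Y \<theta>))
          \<le> ereal (D * \<alpha> / (1 - \<alpha>) * \<epsilon>\<^sup>2)
             + ereal (1 / (real n * (1 - \<alpha>))) * elog (inverse (emeasure (dist_of \<pi>) ?B))
             + ereal ((ln ((D - 1)\<^sup>2 / \<alpha>) - 1) / (1 - \<alpha>) * (1 / real n))"
      if "Y \<in> A" for Y
    proof -
      have Y: "Y \<in> space (sample_lebesgue n)" and pos: "0 < joint_density f n \<theta>s Y"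
        and min: "is_finite_arg_min (\<lambda>q. kl_div lborel q (frac_post \<Theta> f \<pi> \<alpha> n Y)) Q_GP (qhat Y)"
        and tilt: "tilted_evidence Y \<le> ennreal c" and sq: "local_sq ?B Y \<le> ennreal (t\<^sup>2 * b)"
        using good[OF that] by auto
      let ?e = "exp (- \<alpha> * t) * b"
      have "local_sq ?B Y \<le> ennreal (t\<^sup>2) * emeasure (dist_of \<pi>) ?B"
        using sq by (simp add: b_em ennreal_mult')
      from evidence_lower_bound[OF B Y pos t this]
      have ev: "ennreal ?e \<le> evidence Y" by (simp add: b_em ennreal_mult')
      have "ln (c / ?e) = ln c + \<alpha> * t - ln b"
        using b c by (simp add: ln_div ln_mult)
      moreover have "ln c = ln (\<alpha> * a) + ln ((D - 1)\<^sup>2 / \<alpha>)"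
        using a \<alpha> D by (simp add: c_def ln_mult ln_div)
      \<comment> \<open>the slack \<open>\<alpha> a\<close> between \<open>D\<close> and \<open>D - 1\<close> absorbs the logarithmic growth of \<open>c\<close>\<close>
      moreover have "ln (\<alpha> * a) \<le> \<alpha> * a - 1" using \<alpha> a by (intro ln_le_minus_one) auto
      ultimately have "ln (c / ?e) \<le> D * \<alpha> * a - ln b + (ln ((D - 1)\<^sup>2 / \<alpha>) - 1)"
        by (simp add: t_def algebra_simps)
      then have "1 / (real n * (1 - \<alpha>)) * ln (c / ?e)
          \<le> 1 / (real n * (1 - \<alpha>)) * (D * \<alpha> * a - ln b + (ln ((D - 1)\<^sup>2 / \<alpha>) - 1))"
        using \<alpha> by (intro mult_left_mono) auto
      also have "\<dots> = D * \<alpha> / (1 - \<alpha>) * \<epsilon>\<^sup>2 + 1 / (real n * (1 - \<alpha>)) * (- ln b)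
          + (ln ((D - 1)\<^sup>2 / \<alpha>) - 1) / (1 - \<alpha>) * (1 / real n)"
      proof -
        have "1 / (N * s) * (D * \<alpha> * (N * x) - l + C) = D * \<alpha> / s * x + 1 / (N * s) * (- l) + C / s * (1 / N)"
          if "N \<noteq> 0" "s \<noteq> 0" for N s x l C :: real
          using that by (simp add: field_simps)
        from this[of "real n" "1 - \<alpha>" "\<epsilon>\<^sup>2"] show ?thesis using \<alpha> n by (simp add: a_def)
      qed
      finally have "ereal (1 / (real n * (1 - \<alpha>)) * ln (c / ?e))
          \<le> ereal (D * \<alpha> / (1 - \<alpha>) * \<epsilon>\<^sup>2) + ereal (1 / (real n * (1 - \<alpha>))) * ereal (- ln b)
            + ereal ((ln ((D - 1)\<^sup>2 / \<alpha>) - 1) / (1 - \<alpha>) * (1 / real n))" by simp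
      moreover have "elog (inverse (emeasure (dist_of \<pi>) ?B)) = ereal (- ln b)"
        using b by (simp add: b_em inverse_ennreal elog_def ennreal_eq_0_iff ln_inverse)
      ultimately show ?thesis
        using risk_le_of_evidence[OF Y pos n min ev _ tilt c] b by (simp only:) (rule order_trans, auto)
    qed
    then show ?thesis using A fail by (intro bexI[of _ A]) auto
  qed
qed

end

theorem theorem4p2:
  fixes \<Theta> :: "(real^'d) set" and \<theta>s :: "real^'d"
    and f :: "real^'d \<Rightarrow> real^'p \<Rightarrow> real"
    and \<pi> :: "real^'d \<Rightarrow> real"
    and \<alpha> \<epsilon> D :: real
    and qhat :: "nat \<Rightarrow> (nat \<Rightarrow> real^'p) \<Rightarrow> real^'d \<Rightarrow> real"
  assumes "parametric_model \<Theta> f" and "\<theta>s \<in> \<Theta>" and "density_on \<Theta> \<pi>"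
    and "0 < \<alpha>" and "\<alpha> < 1" and "0 < \<epsilon>" and "1 < D"
    and "\<And>n. 1 \<le> n \<Longrightarrow> AE Y in data_measure f n \<theta>s.
           is_finite_arg_min (\<lambda>q. kl_div lborel q (frac_post \<Theta> f \<pi> \<alpha> n Y)) Q_GP (qhat n Y) \<and>
           is_finite_arg_min (\<lambda>q. ereal \<alpha> * Psi \<Theta> f \<pi> \<alpha> \<theta>s n Y q) Q_GP (qhat n Y) \<and>
           absolutely_continuous (dist_of \<pi>) (dist_of (qhat n Y))"
  shows "\<exists>r :: nat \<Rightarrow> real. r \<in> O(\<lambda>n. 1 / real n) \<and>
    (\<forall>n\<ge>1. \<exists>A \<in> sets (data_measure f n \<theta>s).
       measure (data_measure f n \<theta>s) A \<ge> 1 - 2 / ((D - 1)\<^sup>2 * real n * \<epsilon>\<^sup>2) \<and>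
       (\<forall>Y\<in>A.
          eintegral (restrict_space lborel \<Theta>)
            (\<lambda>\<theta>. ereal (1 / real n)
               * renyi_div \<alpha> (sample_lebesgue n) (joint_density f n \<theta>) (joint_density f n \<theta>s)
               * ereal (qhat n Y \<theta>))
          \<le> ereal (D * \<alpha> / (1 - \<alpha>) * \<epsilon>\<^sup>2)
             + ereal (1 / (real n * (1 - \<alpha>))) * elog (inverse (emeasure (dist_of \<pi>) (B_set \<Theta> f n \<theta>s \<epsilon>)))
             + ereal (r n)))"
proof (intro exI conjI allI impI)
  let ?r = "\<lambda>n. (ln ((D - 1)\<^sup>2 / \<alpha>) - 1) / (1 - \<alpha>) * (1 / real n)"
  show "?r \<in> O(\<lambda>n. 1 / real n)"
    by (rule bigoI[where c = "\<bar>(ln ((D - 1)\<^sup>2 / \<alpha>) - 1) / (1 - \<alpha>)\<bar>"],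
        intro always_eventually allI, simp only: real_norm_def abs_mult order_refl)
  fix n :: nat assume n: "1 \<le> n"
  interpret iid_tempered \<Theta> f \<pi> \<theta>s \<alpha> n by unfold_locales fact+
  have "AE Y in data. is_finite_arg_min (\<lambda>q. kl_div lborel q (frac_post \<Theta> f \<pi> \<alpha> n Y)) Q_GP (qhat n Y)"
    using assms(8)[OF n] unfolding data_measure_eq by eventually_elim simp
  from finite_sample_bound[OF assms(6,7) n this]
  show "\<exists>A \<in> sets (data_measure f n \<theta>s).
       measure (data_measure f n \<theta>s) A \<ge> 1 - 2 / ((D - 1)\<^sup>2 * real n * \<epsilon>\<^sup>2) \<and>
       (\<forall>Y\<in>A.
          eintegral (restrict_space lborel \<Theta>)
            (\<lambda>\<theta>. ereal (1 / real n)
               * renyi_div \<alpha> (sample_lebesgue n) (joint_density f n \<theta>) (joint_density f n \<theta>s)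
               * ereal (qhat n Y \<theta>))
          \<le> ereal (D * \<alpha> / (1 - \<alpha>) * \<epsilon>\<^sup>2)
             + ereal (1 / (real n * (1 - \<alpha>))) * elog (inverse (emeasure (dist_of \<pi>) (B_set \<Theta> f n \<theta>s \<epsilon>)))
             + ereal (?r n))"
    unfolding data_measure_eq .
qed

end
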